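(* Let $(M,g)$ be a smooth Riemannian manifold of dimension $n>1$ and let $(G,J)$ be the natural almost Hermitian structure of diagonal type on $T^*M$ determined by smooth functions $a_1,b_1,\lambda,\mu:[0,\infty)\to\mathbb{R}$ with $a_1>0$, $a_1+2tb_1>0$, $\lambda>0$, $\lambda+2t\mu>0$ for all $t\ge 0$. Then $(G,J)$ is almost Kählerian if and only if $$\mu=\lambda'.$$
   Context: Let $(M,g)$ be an $n$-dimensional Riemannian manifold and $\pi:T^*M\to M$ its cotangent bundle. A local chart $(U,x^1,\dots,x^n)$ of $M$ induces a chart $(\pi^{-1}(U),q^1,\dots,q^n,p_1,\dots,p_n)$ of $T^*M$ with $q^i=x^i\circ\pi$ and $p=p_i\,dx^i_{\pi(p)}$. Summation convention is used. Let $\Gamma^k_{ij}$ be the Christoffel symbols of the Levi-Civita connection of $g$, $(g^{ij})$ the inverse matrix of $(g_{ij})$, $\Gamma^0_{ih}=p_k\Gamma^k_{ih}$, $g^{0i}=p_hg^{hi}$, $\partial^i=\partial/\partial p_i$ and $\delta_i=\partial/\partial q^i+\Gamma^0_{ih}\,\partial/\partial p_h$. Then $(\partial^1,\dots,\partial^n,\delta_1,\dots,\delta_n)$ is a local frame on $T^*M$. Let $t=\frac12 g^{ik}p_ip_k\in[0,\infty)$ be the energy density; functions of $t$ are regarded as functions on $T^*M$, and a prime denotes $d/dt$. The natural almost Hermitian structure $(G,J)$ of diagonal type determined by $a_1,b_1,\lambda,\mu$ is $$J\delta_i=a_1g_{ij}\partial^j+b_1p_ip_j\partial^j,\qquad J\partial^i=-a_2g^{ij}\delta_j-b_2g^{0i}g^{0j}\delta_j,$$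 $$G(\delta_i,\delta_j)=c_1g_{ij}+d_1p_ip_j,\qquad G(\partial^i,\partial^j)=c_2g^{ij}+d_2g^{0i}g^{0j},\qquad G(\partial^i,\delta_j)=0,$$ where $a_2=\frac1{a_1}$, $b_2=-\frac{b_1}{a_1(a_1+2tb_1)}$, $c_1=\lambda a_1$, $c_2=\lambda a_2$, $d_1=\lambda b_1+\mu(a_1+2tb_1)$, $d_2=\lambda b_2+\mu(a_2+2tb_2)$. The structure is almost Kählerian if the $2$-form $\phi(X,Y)=G(X,JY)$ is closed. All objects are smooth. *)

theory Defs
  imports "HOL-Analysis.Analysis"
begin

section \<open>Smooth maps\<close>

primrec Ck_on :: "nat \<Rightarrow> 'a::euclidean_space set \<Rightarrow> ('a \<Rightarrow> 'b::real_normed_vector) \<Rightarrow> bool" where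
  "Ck_on 0 S f \<longleftrightarrow> continuous_on S f"
| "Ck_on (Suc k) S f \<longleftrightarrow> f differentiable_on S \<and>
     (\<forall>i\<in>Basis. Ck_on k S (\<lambda>x. frechet_derivative f (at x) i))"

text \<open>Meant for open \<open>S\<close> only: the derivatives in \<^const>\<open>Ck_on\<close> are not taken within \<open>S\<close>.\<close>

definition smooth_on :: "'a::euclidean_space set \<Rightarrow> ('a \<Rightarrow> 'b::real_normed_vector) \<Rightarrow> bool" where
  "smooth_on S f \<longleftrightarrow> (\<forall>k. Ck_on k S f)"

text \<open>Smooth functions \<open>[0,\<infinity>) \<rightarrow> \<real>\<close>, with one-sided derivatives of all orders at \<open>0\<close>;
  the values at negative arguments are irrelevant.\<close>

definition smooth_on_half_line :: "(real \<Rightarrow> real) \<Rightarrow> bool" where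
  "smooth_on_half_line f \<longleftrightarrow> (\<exists>D :: nat \<Rightarrow> real \<Rightarrow> real. D 0 = f \<and>
     (\<forall>k. \<forall>t\<ge>0. (D k has_real_derivative D (Suc k) t) (at t within {0..})))"


section \<open>Manifolds and their tangent spaces\<close>

text \<open>A chart is a pair of its domain and its coordinate map (irrelevant off the domain).\<close>

type_synonym ('m, 'e) chart = "'m set \<times> ('m \<Rightarrow> 'e)"

definition chart_inv :: "('m, 'e) chart \<Rightarrow> 'e \<Rightarrow> 'm" where
  "chart_inv c = inv_into (fst c) (snd c)"

definition transition :: "('m, 'e) chart \<Rightarrow> ('m, 'e) chart \<Rightarrow> 'e \<Rightarrow> 'e" where
  "transition c d = snd d \<circ> chart_inv c"

text \<open>The atlas need not be maximal; the maximal ones are included.\<close>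

definition smooth_atlas ::
  "('m::{t2_space,second_countable_topology}, 'e::euclidean_space) chart set \<Rightarrow> bool" where
  "smooth_atlas A \<longleftrightarrow>
     (\<Union>c\<in>A. fst c) = UNIV \<and>
     (\<forall>c\<in>A. open (fst c) \<and> open (snd c ` fst c) \<and>
        homeomorphism (fst c) (snd c ` fst c) (snd c) (chart_inv c)) \<and>
     (\<forall>c\<in>A. \<forall>d\<in>A. smooth_on (snd c ` (fst c \<inter> fst d)) (transition c d))"

definition charts_at :: "('m, 'e) chart set \<Rightarrow> 'm \<Rightarrow> ('m, 'e) chart set" where
  "charts_at A x = {c\<in>A. x \<in> fst c}"

text \<open>A tangent vector at \<open>x\<close> is the family \<open>v\<close> of its component vectors \<open>v c\<close> in the charts \<open>c\<close>
  around \<open>x\<close>, which transform by the Jacobians of the coordinate changes.  Vector space operations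
  are those of the components.  The following notions use only the charts, so that they also apply
  to the cotangent bundle below, whose points form a subset of a type without a topology.\<close>

type_synonym ('m, 'e) tangent_vector = "('m, 'e) chart \<Rightarrow> 'e"

definition tangent_space ::
  "('m, 'e::euclidean_space) chart set \<Rightarrow> 'm \<Rightarrow> ('m, 'e) tangent_vector set" where
  "tangent_space A x = {v.
     (\<forall>c. c \<notin> charts_at A x \<longrightarrow> v c = 0) \<and>
     (\<forall>c\<in>charts_at A x. \<forall>d\<in>charts_at A x.
        v d = frechet_derivative (transition c d) (at (snd c x)) (v c))}"

text \<open>The tangent vector at \<open>x\<close> with component vector \<open>u\<close> in the chart \<open>c\<close>.\<close>

definition chart_vector ::
  "('m, 'e::euclidean_space) chart set \<Rightarrow> 'm \<Rightarrow> ('m, 'e) chart \<Rightarrow> 'e \<Rightarrow> ('m, 'e) tangent_vector" where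
  "chart_vector A x c u = (\<lambda>d. if d \<in> charts_at A x
     then frechet_derivative (transition c d) (at (snd c x)) u else 0)"

definition linear_form_on ::
  "('m, 'e::euclidean_space) tangent_vector set \<Rightarrow> (('m, 'e) tangent_vector \<Rightarrow> real) \<Rightarrow> bool" where
  "linear_form_on T f \<longleftrightarrow> (\<forall>v\<in>T. \<forall>w\<in>T. \<forall>r s.
     f (\<lambda>c. r *\<^sub>R v c + s *\<^sub>R w c) = r * f v + s * f w)"

definition symmetric_bilinear_form_on ::
  "('m, 'e::euclidean_space) tangent_vector set \<Rightarrow>
   (('m, 'e) tangent_vector \<Rightarrow> ('m, 'e) tangent_vector \<Rightarrow> real) \<Rightarrow> bool" where
  "symmetric_bilinear_form_on T b \<longleftrightarrow>
     (\<forall>v\<in>T. linear_form_on T (b v)) \<and> (\<forall>v\<in>T. \<forall>w\<in>T. b v w = b w v)"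

definition endomorphism_on ::
  "('m, 'e::euclidean_space) tangent_vector set \<Rightarrow>
   (('m, 'e) tangent_vector \<Rightarrow> ('m, 'e) tangent_vector) \<Rightarrow> bool" where
  "endomorphism_on T J \<longleftrightarrow> (\<forall>v\<in>T. J v \<in> T) \<and> (\<forall>v\<in>T. \<forall>w\<in>T. \<forall>r s.
     J (\<lambda>c. r *\<^sub>R v c + s *\<^sub>R w c) = (\<lambda>c. r *\<^sub>R J v c + s *\<^sub>R J w c))"

type_synonym ('m, 'e) covariant2 =
  "'m \<Rightarrow> ('m, 'e) tangent_vector \<Rightarrow> ('m, 'e) tangent_vector \<Rightarrow> real"

type_synonym ('m, 'e) endomorphism_field =
  "'m \<Rightarrow> ('m, 'e) tangent_vector \<Rightarrow> ('m, 'e) tangent_vector"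

text \<open>The local representative, in the chart \<open>c\<close>, of a covariant 2-tensor field.\<close>

definition local_form ::
  "('m, 'e::euclidean_space) chart set \<Rightarrow> ('m, 'e) covariant2 \<Rightarrow> ('m, 'e) chart \<Rightarrow>
   'e \<Rightarrow> 'e \<Rightarrow> 'e \<Rightarrow> real" where
  "local_form A \<phi> c y u v =
     \<phi> (chart_inv c y) (chart_vector A (chart_inv c y) c u) (chart_vector A (chart_inv c y) c v)"

text \<open>The exterior derivative of a 2-form, evaluated on constant coordinate vector fields
  (whose brackets vanish).\<close>

definition exterior_derivative ::
  "('m, 'e::euclidean_space) chart set \<Rightarrow> ('m, 'e) covariant2 \<Rightarrow> ('m, 'e) chart \<Rightarrow>
   'e \<Rightarrow> 'e \<Rightarrow> 'e \<Rightarrow> 'e \<Rightarrow> real" where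
  "exterior_derivative A \<phi> c y u v w =
     frechet_derivative (\<lambda>z. local_form A \<phi> c z v w) (at y) u +
     frechet_derivative (\<lambda>z. local_form A \<phi> c z w u) (at y) v +
     frechet_derivative (\<lambda>z. local_form A \<phi> c z u v) (at y) w"

definition closed_2form ::
  "('m, 'e::euclidean_space) chart set \<Rightarrow> ('m, 'e) covariant2 \<Rightarrow> bool" where
  "closed_2form A \<phi> \<longleftrightarrow> (\<forall>c\<in>A. \<forall>y\<in>snd c ` fst c.
     (\<forall>u v. (\<lambda>z. local_form A \<phi> c z u v) differentiable (at y)) \<and>
     (\<forall>u v w. exterior_derivative A \<phi> c y u v w = 0))"

definition fundamental_form ::
  "('m, 'e) covariant2 \<Rightarrow> ('m, 'e) endomorphism_field \<Rightarrow> ('m, 'e) covariant2" where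
  "fundamental_form G J x X Y = G x X (J x Y)"

definition almost_kaehlerian ::
  "('m, 'e::euclidean_space) chart set \<Rightarrow> ('m, 'e) covariant2 \<Rightarrow>
   ('m, 'e) endomorphism_field \<Rightarrow> bool" where
  "almost_kaehlerian A G J \<longleftrightarrow> closed_2form A (fundamental_form G J)"


section \<open>Riemannian manifolds\<close>

abbreviation basis_vec :: "'n::finite \<Rightarrow> real^'n" where
  "basis_vec i \<equiv> axis i 1"

abbreviation coord_vector ::
  "('m, real^'n) chart set \<Rightarrow> 'm \<Rightarrow> ('m, real^'n) chart \<Rightarrow> 'n \<Rightarrow> ('m, real^'n) tangent_vector" where
  "coord_vector A x c i \<equiv> chart_vector A x c (basis_vec i)"

text \<open>The matrix \<open>(g\<^sub>i\<^sub>j)\<close> in the chart \<open>c\<close>, as a function of the coordinates.\<close>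

definition metric_coeff ::
  "('m, real^'n) chart set \<Rightarrow> ('m, real^'n) covariant2 \<Rightarrow> ('m, real^'n) chart \<Rightarrow>
   real^'n \<Rightarrow> real^'n^'n" where
  "metric_coeff A g c y = (\<chi> i j. local_form A g c y (basis_vec i) (basis_vec j))"

definition riemannian_metric ::
  "('m, real^'n) chart set \<Rightarrow> ('m, real^'n) covariant2 \<Rightarrow> bool" where
  "riemannian_metric A g \<longleftrightarrow>
     (\<forall>x. symmetric_bilinear_form_on (tangent_space A x) (g x)) \<and>
     (\<forall>x. \<forall>v\<in>tangent_space A x. v \<noteq> (\<lambda>_. 0) \<longrightarrow> g x v v > 0) \<and>
     (\<forall>c\<in>A. \<forall>i j. smooth_on (snd c ` fst c) (\<lambda>y. metric_coeff A g c y $ i $ j))"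

definition riemannian_manifold ::
  "('m::{t2_space,second_countable_topology}, real^'n) chart set \<Rightarrow>
   ('m, real^'n) covariant2 \<Rightarrow> bool" where
  "riemannian_manifold A g \<longleftrightarrow> smooth_atlas A \<and> riemannian_metric A g"

definition metric_inv_coeff ::
  "('m, real^'n) chart set \<Rightarrow> ('m, real^'n) covariant2 \<Rightarrow> ('m, real^'n) chart \<Rightarrow>
   real^'n \<Rightarrow> real^'n^'n" where
  "metric_inv_coeff A g c y = matrix_inv (metric_coeff A g c y)"

text \<open>\<open>\<partial>g\<^sub>i\<^sub>j / \<partial>x\<^sup>k\<close>\<close>

definition metric_coeff_deriv ::
  "('m, real^'n) chart set \<Rightarrow> ('m, real^'n) covariant2 \<Rightarrow> ('m, real^'n) chart \<Rightarrow>
   real^'n \<Rightarrow> 'n \<Rightarrow> 'n \<Rightarrow> 'n \<Rightarrow> real" where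
  "metric_coeff_deriv A g c y k i j =
     frechet_derivative (\<lambda>z. metric_coeff A g c z $ i $ j) (at y) (basis_vec k)"

text \<open>The Christoffel symbols \<open>\<Gamma>\<^sup>k\<^sub>i\<^sub>j\<close> of the Levi-Civita connection of \<open>g\<close>.\<close>

definition christoffel ::
  "('m, real^'n) chart set \<Rightarrow> ('m, real^'n) covariant2 \<Rightarrow> ('m, real^'n) chart \<Rightarrow>
   real^'n \<Rightarrow> 'n \<Rightarrow> 'n \<Rightarrow> 'n \<Rightarrow> real" where
  "christoffel A g c y k i j = (1/2) * (\<Sum>l\<in>UNIV. metric_inv_coeff A g c y $ k $ l *
     (metric_coeff_deriv A g c y i j l + metric_coeff_deriv A g c y j i l
      - metric_coeff_deriv A g c y l i j))"


section \<open>The cotangent bundle\<close>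

type_synonym ('m, 'n) covector = "('m, real^'n) tangent_vector \<Rightarrow> real"

text \<open>The second condition makes the functionals on \<open>T\<^sub>xM\<close> unique as functions on the whole type.\<close>

definition cotangent_space ::
  "('m, real^'n) chart set \<Rightarrow> 'm \<Rightarrow> ('m, 'n) covector set" where
  "cotangent_space A x = {p. linear_form_on (tangent_space A x) p \<and>
     (\<forall>v. v \<notin> tangent_space A x \<longrightarrow> p v = 0)}"

definition cotangent_bundle ::
  "('m, real^'n) chart set \<Rightarrow> ('m \<times> ('m, 'n) covector) set" where
  "cotangent_bundle A = {(x, p). p \<in> cotangent_space A x}"

text \<open>The components \<open>p\<^sub>i = p(\<partial>/\<partial>x\<^sup>i)\<close> of a covector.\<close>

definition covector_coeff ::
  "('m, real^'n) chart set \<Rightarrow> ('m, real^'n) chart \<Rightarrow> 'm \<times> ('m, 'n) covector \<Rightarrow> real^'n" where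
  "covector_coeff A c \<xi> = (\<chi> i. snd \<xi> (coord_vector A (fst \<xi>) c i))"

text \<open>The chart \<open>(\<pi>\<^sup>-\<^sup>1(U), q, p)\<close> induced by a chart \<open>c = (U, x)\<close>.\<close>

definition cotangent_chart ::
  "('m, real^'n) chart set \<Rightarrow> ('m, real^'n) chart \<Rightarrow>
   ('m \<times> ('m, 'n) covector, (real^'n) \<times> (real^'n)) chart" where
  "cotangent_chart A c =
     ({\<xi> \<in> cotangent_bundle A. fst \<xi> \<in> fst c}, \<lambda>\<xi>. (snd c (fst \<xi>), covector_coeff A c \<xi>))"

definition cotangent_atlas ::
  "('m, real^'n) chart set \<Rightarrow> ('m \<times> ('m, 'n) covector, (real^'n) \<times> (real^'n)) chart set" where
  "cotangent_atlas A = cotangent_chart A ` A"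

definition energy_density ::
  "('m, real^'n) chart set \<Rightarrow> ('m, real^'n) covariant2 \<Rightarrow> ('m, real^'n) chart \<Rightarrow>
   'm \<times> ('m, 'n) covector \<Rightarrow> real" where
  "energy_density A g c \<xi> = (1/2) * (\<Sum>i\<in>UNIV. \<Sum>k\<in>UNIV.
     metric_inv_coeff A g c (snd c (fst \<xi>)) $ i $ k *
       covector_coeff A c \<xi> $ i * covector_coeff A c \<xi> $ k)"

text \<open>\<open>g\<^sup>0\<^sup>i = p\<^sub>h g\<^sup>h\<^sup>i\<close>\<close>

definition raised_coeff ::
  "('m, real^'n) chart set \<Rightarrow> ('m, real^'n) covariant2 \<Rightarrow> ('m, real^'n) chart \<Rightarrow>
   'm \<times> ('m, 'n) covector \<Rightarrow> 'n \<Rightarrow> real" where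
  "raised_coeff A g c \<xi> i = (\<Sum>h\<in>UNIV.
     covector_coeff A c \<xi> $ h * metric_inv_coeff A g c (snd c (fst \<xi>)) $ h $ i)"

text \<open>\<open>\<Gamma>\<^sup>0\<^sub>i\<^sub>h = p\<^sub>k \<Gamma>\<^sup>k\<^sub>i\<^sub>h\<close>\<close>

definition christoffel0 ::
  "('m, real^'n) chart set \<Rightarrow> ('m, real^'n) covariant2 \<Rightarrow> ('m, real^'n) chart \<Rightarrow>
   'm \<times> ('m, 'n) covector \<Rightarrow> 'n \<Rightarrow> 'n \<Rightarrow> real" where
  "christoffel0 A g c \<xi> i h = (\<Sum>k\<in>UNIV.
     covector_coeff A c \<xi> $ k * christoffel A g c (snd c (fst \<xi>)) k i h)"

text \<open>The local frame: \<open>\<partial>\<^sup>i = \<partial>/\<partial>p\<^sub>i\<close> and \<open>\<delta>\<^sub>i = \<partial>/\<partial>q\<^sup>i + \<Gamma>\<^sup>0\<^sub>i\<^sub>h \<partial>/\<partial>p\<^sub>h\<close>.\<close>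

definition vertical_frame ::
  "('m, real^'n) chart set \<Rightarrow> ('m, real^'n) chart \<Rightarrow> 'm \<times> ('m, 'n) covector \<Rightarrow> 'n \<Rightarrow>
   ('m \<times> ('m, 'n) covector, (real^'n) \<times> (real^'n)) tangent_vector" where
  "vertical_frame A c \<xi> i =
     chart_vector (cotangent_atlas A) \<xi> (cotangent_chart A c) (0, basis_vec i)"

definition horizontal_frame ::
  "('m, real^'n) chart set \<Rightarrow> ('m, real^'n) covariant2 \<Rightarrow> ('m, real^'n) chart \<Rightarrow>
   'm \<times> ('m, 'n) covector \<Rightarrow> 'n \<Rightarrow>
   ('m \<times> ('m, 'n) covector, (real^'n) \<times> (real^'n)) tangent_vector" where
  "horizontal_frame A g c \<xi> i =
     chart_vector (cotangent_atlas A) \<xi> (cotangent_chart A c)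
       (basis_vec i, \<chi> h. christoffel0 A g c \<xi> i h)"


section \<open>Natural almost Hermitian structures of diagonal type\<close>

text \<open>\<open>G\<close> and \<open>J\<close> are tensor fields on \<open>T\<^sup>*M\<close>, given on the local frame induced by each chart
  of \<open>M\<close>; this determines them uniquely on tangent vectors.\<close>

definition natural_diagonal_structure ::
  "('m, real^'n) chart set \<Rightarrow> ('m, real^'n) covariant2 \<Rightarrow>
   (real \<Rightarrow> real) \<Rightarrow> (real \<Rightarrow> real) \<Rightarrow> (real \<Rightarrow> real) \<Rightarrow> (real \<Rightarrow> real) \<Rightarrow>
   ('m \<times> ('m, 'n) covector, (real^'n) \<times> (real^'n)) covariant2 \<Rightarrow>
   ('m \<times> ('m, 'n) covector, (real^'n) \<times> (real^'n)) endomorphism_field \<Rightarrow> bool" where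
  "natural_diagonal_structure A g a1 b1 lam mu G J \<longleftrightarrow>
    (\<forall>\<xi>\<in>cotangent_bundle A.
       symmetric_bilinear_form_on (tangent_space (cotangent_atlas A) \<xi>) (G \<xi>) \<and>
       endomorphism_on (tangent_space (cotangent_atlas A) \<xi>) (J \<xi>)) \<and>
    (\<forall>c\<in>A. \<forall>\<xi>\<in>fst (cotangent_chart A c).
      let gl = metric_coeff A g c (snd c (fst \<xi>));
          gu = metric_inv_coeff A g c (snd c (fst \<xi>));
          g0 = raised_coeff A g c \<xi>;
          p = covector_coeff A c \<xi>;
          V = vertical_frame A c \<xi>;
          H = horizontal_frame A g c \<xi>;
          t = energy_density A g c \<xi>;
          \<alpha>1 = a1 t; \<beta>1 = b1 t; l = lam t; m = mu t;
          \<alpha>2 = 1 / \<alpha>1;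
          \<beta>2 = - \<beta>1 / (\<alpha>1 * (\<alpha>1 + 2 * t * \<beta>1));
          c1 = l * \<alpha>1;
          c2 = l * \<alpha>2;
          d1 = l * \<beta>1 + m * (\<alpha>1 + 2 * t * \<beta>1);
          d2 = l * \<beta>2 + m * (\<alpha>2 + 2 * t * \<beta>2)
      in \<forall>i. J \<xi> (H i) = (\<lambda>C. \<Sum>j\<in>UNIV. (\<alpha>1 * gl $ i $ j + \<beta>1 * p $ i * p $ j) *\<^sub>R V j C) \<and>
             J \<xi> (V i) = (\<lambda>C. \<Sum>j\<in>UNIV. (- \<alpha>2 * gu $ i $ j - \<beta>2 * g0 i * g0 j) *\<^sub>R H j C) \<and>
             (\<forall>j. G \<xi> (H i) (H j) = c1 * gl $ i $ j + d1 * p $ i * p $ j \<and>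
                  G \<xi> (V i) (V j) = c2 * gu $ i $ j + d2 * g0 i * g0 j \<and>
                  G \<xi> (V i) (H j) = 0))"

end

theory Submission
  imports Defs
begin

text \<open>
  Let \<open>D p\<^sub>i = dp\<^sub>i - \<Gamma>\<^sup>0\<^sub>i\<^sub>h dq\<^sup>h\<close> be the vertical part of a vector.  The relations between the coefficients
  collapse the fundamental form to
  \<open>\<phi> = \<lambda> D p\<^sub>i \<and> dq\<^sup>i + \<mu> g\<^sup>0\<^sup>i D p\<^sub>i \<and> p\<^sub>j dq\<^sup>j\<close>.  Since \<open>\<Gamma>\<close> is symmetric,
  \<open>D p\<^sub>i \<and> dq\<^sup>i = dp\<^sub>i \<and> dq\<^sup>i =: \<omega>\<close>, and since the connection is metric, \<open>g\<^sup>0\<^sup>i D p\<^sub>i = dt\<close>.  Hence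
  \<open>\<phi> = \<lambda> \<omega> + \<mu> dt \<and> \<theta>\<close> with \<open>\<theta> = p\<^sub>j dq\<^sup>j\<close>, \<open>d\<theta> = \<omega>\<close>, and so \<open>d\<phi> = (\<lambda>' - \<mu>) dt \<and> \<omega>\<close>.
  For \<open>n > 1\<close> the form \<open>dt \<and> \<omega>\<close> vanishes nowhere off the zero section, where \<open>t\<close> takes all values in
  \<open>(0,\<infinity>)\<close>; the equation \<open>\<mu> = \<lambda>'\<close> at \<open>t = 0\<close> follows by continuity.
\<close>

section \<open>Calculus\<close>

text \<open>The difference is symmetric in \<open>X\<close> and \<open>Y\<close>, which forces symmetry of the second derivative;
  the mean value theorem is applied to \<open>\<tau> \<mapsto> E (x + \<tau> X + s Y) - E (x + \<tau> X)\<close>.\<close>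

lemma second_difference_quotient:
  fixes E :: "'a::real_normed_vector \<Rightarrow> real"
  assumes S: "open S" "x \<in> S"
    and E: "\<And>z. z \<in> S \<Longrightarrow> (E has_derivative dE z) (at z)"
    and h: "((\<lambda>z. dE z X) has_derivative h') (at x)"
    and e: "0 < e"
  shows "\<exists>d>0. \<forall>s. 0 < s \<and> s < d \<longrightarrow>
    \<bar>E (x + s *\<^sub>R X + s *\<^sub>R Y) - E (x + s *\<^sub>R X) - E (x + s *\<^sub>R Y) + E x - s\<^sup>2 * h' Y\<bar> \<le> e * s\<^sup>2"
proof -
  \<comment> \<open>The summand 1 keeps \<open>N\<close> positive even when \<open>X\<close> and
    \<open>Y\<close> vanish, so that division by \<open>N\<close> is allowed.\<close>
  define N where "N = norm X + norm Y + 1"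
  have N: "N > 0" "norm X \<le> N" "norm Y \<le> N" "norm X + norm Y \<le> N"
    by (auto simp: N_def add_nonneg_pos)
  interpret h': bounded_linear h' using h by (rule has_derivative_bounded_linear)
  \<comment> \<open>The linear approximation is used at two points below, each with error
    \<open>e' * (s * N)\<close>; this choice makes the total \<open>e * s\<close>.\<close>
  define e' where "e' = e / (2 * N)"
  have "e' > 0" using e N by (simp add: e'_def)
  then obtain d1 where d1: "d1 > 0"
    "\<And>y. norm (y - x) < d1 \<Longrightarrow> \<bar>dE y X - dE x X - h' (y - x)\<bar> \<le> e' * norm (y - x)"
    using h unfolding has_derivative_at_alt by (metis real_norm_def)
  obtain d2 where d2: "d2 > 0" "ball x d2 \<subseteq> S"
    using S open_contains_ball by blast
  \<comment> \<open>For \<open>s < d\<close> the whole parallelogram with sides \<open>s X\<close>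
    and \<open>s Y\<close> at \<open>x\<close> lies in \<open>S\<close> and in the range where the
    linear approximation holds.\<close>
  define d where "d = min d1 d2 / N"
  have "d > 0" using d1 d2 N by (simp add: d_def)
  moreover have "\<bar>E (x + s *\<^sub>R X + s *\<^sub>R Y) - E (x + s *\<^sub>R X) - E (x + s *\<^sub>R Y) + E x - s\<^sup>2 * h' Y\<bar> \<le> e * s\<^sup>2"
    if s: "0 < s" "s < d" for s
  proof -
    have sN: "s * N < min d1 d2"
      using s N by (simp add: d_def pos_less_divide_eq)
    have small: "norm (\<tau> *\<^sub>R X + \<sigma> *\<^sub>R Y) \<le> s * N" if "0 \<le> \<tau>" "\<tau> \<le> s" "0 \<le> \<sigma>" "\<sigma> \<le> s" for \<tau> \<sigma>
    proof -
      have "norm (\<tau> *\<^sub>R X + \<sigma> *\<^sub>R Y) \<le> \<tau> * norm X + \<sigma> * norm Y"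
        using norm_triangle_ineq[of "\<tau> *\<^sub>R X" "\<sigma> *\<^sub>R Y"] that by simp
      also have "\<dots> \<le> s * norm X + s * norm Y"
        using that by (intro add_mono mult_right_mono) auto
      also have "\<dots> \<le> s * N" using N s by (simp flip: distrib_left)
      finally show ?thesis .
    qed
    have inS: "x + \<tau> *\<^sub>R X + \<sigma> *\<^sub>R Y \<in> S" if "0 \<le> \<tau>" "\<tau> \<le> s" "0 \<le> \<sigma>" "\<sigma> \<le> s" for \<tau> \<sigma>
    proof -
      have "dist x (x + \<tau> *\<^sub>R X + \<sigma> *\<^sub>R Y) = norm (\<tau> *\<^sub>R X + \<sigma> *\<^sub>R Y)"
        by (simp add: dist_norm add.assoc flip: norm_minus_cancel[of "\<tau> *\<^sub>R X + \<sigma> *\<^sub>R Y"])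
      then show ?thesis using small[OF that] sN d2 by auto
    qed
    have est: "\<bar>dE (x + \<tau> *\<^sub>R X + \<sigma> *\<^sub>R Y) X - dE x X - (\<tau> * h' X + \<sigma> * h' Y)\<bar> \<le> e' * (s * N)"
      if "0 \<le> \<tau>" "\<tau> \<le> s" "0 \<le> \<sigma>" "\<sigma> \<le> s" for \<tau> \<sigma>
    proof -
      have eq: "x + \<tau> *\<^sub>R X + \<sigma> *\<^sub>R Y - x = \<tau> *\<^sub>R X + \<sigma> *\<^sub>R Y" by simp
      have "\<bar>dE (x + \<tau> *\<^sub>R X + \<sigma> *\<^sub>R Y) X - dE x X - h' (\<tau> *\<^sub>R X + \<sigma> *\<^sub>R Y)\<bar>
        \<le> e' * norm (\<tau> *\<^sub>R X + \<sigma> *\<^sub>R Y)"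
        using d1(2)[of "x + \<tau> *\<^sub>R X + \<sigma> *\<^sub>R Y"] small[OF that] sN unfolding eq by simp
      also have "\<dots> \<le> e' * (s * N)"
        using small[OF that] \<open>e' > 0\<close> by simp
      finally show ?thesis by (simp add: h'.add h'.scaleR)
    qed
    define f where "f = (\<lambda>\<tau>. E (x + \<tau> *\<^sub>R X + s *\<^sub>R Y) - E (x + \<tau> *\<^sub>R X))"
    have der: "(f has_derivative (\<lambda>k. k * (dE (x + \<tau> *\<^sub>R X + s *\<^sub>R Y) X - dE (x + \<tau> *\<^sub>R X) X))) (at \<tau> within {0..s})"
      if "0 \<le> \<tau>" "\<tau> \<le> s" for \<tau>
    proof -
      have z1: "x + \<tau> *\<^sub>R X + s *\<^sub>R Y \<in> S" and z2: "x + \<tau> *\<^sub>R X \<in> S"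
        using inS[of \<tau> s] inS[of \<tau> 0] that s by auto
      have l1: "dE (x + \<tau> *\<^sub>R X + s *\<^sub>R Y) (k *\<^sub>R X) = k * dE (x + \<tau> *\<^sub>R X + s *\<^sub>R Y) X"
        and l2: "dE (x + \<tau> *\<^sub>R X) (k *\<^sub>R X) = k * dE (x + \<tau> *\<^sub>R X) X" for k
        using bounded_linear.linear[OF has_derivative_bounded_linear[OF E[OF z1]]]
          bounded_linear.linear[OF has_derivative_bounded_linear[OF E[OF z2]]]
        by (auto simp: linear_cmul)
      have "((\<lambda>\<tau>. E (x + \<tau> *\<^sub>R X + s *\<^sub>R Y)) has_derivative (\<lambda>k. dE (x + \<tau> *\<^sub>R X + s *\<^sub>R Y) (k *\<^sub>R X))) (at \<tau>)"
        by (rule has_derivative_compose[where f="\<lambda>\<tau>. x + \<tau> *\<^sub>R X + s *\<^sub>R Y", OF _ E[OF z1]])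
          (auto intro!: derivative_eq_intros)
      moreover have "((\<lambda>\<tau>. E (x + \<tau> *\<^sub>R X)) has_derivative (\<lambda>k. dE (x + \<tau> *\<^sub>R X) (k *\<^sub>R X))) (at \<tau>)"
        by (rule has_derivative_compose[where f="\<lambda>\<tau>. x + \<tau> *\<^sub>R X", OF _ E[OF z2]])
          (auto intro!: derivative_eq_intros)
      ultimately have "(f has_derivative (\<lambda>k. dE (x + \<tau> *\<^sub>R X + s *\<^sub>R Y) (k *\<^sub>R X) - dE (x + \<tau> *\<^sub>R X) (k *\<^sub>R X))) (at \<tau>)"
        unfolding f_def by (rule has_derivative_diff)
      then show ?thesis by (simp add: l1 l2 right_diff_distrib has_derivative_at_withinI)
    qed
    obtain \<tau> where \<tau>: "\<tau> \<in> {0..s}"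
      "f s - f 0 = (s - 0) * (dE (x + \<tau> *\<^sub>R X + s *\<^sub>R Y) X - dE (x + \<tau> *\<^sub>R X) X)"
      using mvt_very_simple[OF less_imp_le[OF s(1)] der] by auto
    \<comment> \<open>Subtracting the estimates at \<open>s\<close> and at 0 in direction
      \<open>Y\<close> cancels the unknown contribution \<open>\<tau> * h' X\<close>.\<close>
    have "\<bar>dE (x + \<tau> *\<^sub>R X + s *\<^sub>R Y) X - dE (x + \<tau> *\<^sub>R X) X - s * h' Y\<bar> \<le> 2 * (e' * (s * N))"
      using est[of \<tau> s] est[of \<tau> 0] \<tau> s by (auto simp: abs_le_iff)
    also have "\<dots> = e * s" using N by (simp add: e'_def)
    finally have "s * \<bar>dE (x + \<tau> *\<^sub>R X + s *\<^sub>R Y) X - dE (x + \<tau> *\<^sub>R X) X - s * h' Y\<bar> \<le> s * (e * s)"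
      using s by (intro mult_left_mono) auto
    moreover have "E (x + s *\<^sub>R X + s *\<^sub>R Y) - E (x + s *\<^sub>R X) - E (x + s *\<^sub>R Y) + E x - s\<^sup>2 * h' Y
      = s * (dE (x + \<tau> *\<^sub>R X + s *\<^sub>R Y) X - dE (x + \<tau> *\<^sub>R X) X - s * h' Y)"
      using \<tau>(2) by (simp add: f_def algebra_simps power2_eq_square)
    ultimately show ?thesis
      using s by (simp add: abs_mult power2_eq_square mult_ac)
  qed
  ultimately show ?thesis by blast
qed

text \<open>The same second difference, divided by \<open>s\<^sup>2\<close>, approximates
  \<open>h Y\<close> and, with \<open>X\<close> and \<open>Y\<close> exchanged, also
  \<open>k X\<close>.\<close>

lemma symmetric_second_derivative:
  fixes E :: "'a::real_normed_vector \<Rightarrow> real"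
  assumes S: "open S" "x \<in> S"
    and E: "\<And>z. z \<in> S \<Longrightarrow> (E has_derivative dE z) (at z)"
    and X: "((\<lambda>z. dE z X) has_derivative h) (at x)"
    and Y: "((\<lambda>z. dE z Y) has_derivative k) (at x)"
  shows "h Y = k X"
proof -
  have "\<bar>h Y - k X\<bar> \<le> 0 + e" if "e > 0" for e
  proof -
    have "0 < e / 2" using that by simp
    from second_difference_quotient[OF S E X this, of Y] second_difference_quotient[OF S E Y this, of X]
    obtain d1 d2 where d: "d1 > 0" "d2 > 0"
      "\<And>s. 0 < s \<and> s < d1 \<Longrightarrow>
        \<bar>E (x + s *\<^sub>R X + s *\<^sub>R Y) - E (x + s *\<^sub>R X) - E (x + s *\<^sub>R Y) + E x - s\<^sup>2 * h Y\<bar> \<le> e / 2 * s\<^sup>2"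
      "\<And>s. 0 < s \<and> s < d2 \<Longrightarrow>
        \<bar>E (x + s *\<^sub>R Y + s *\<^sub>R X) - E (x + s *\<^sub>R Y) - E (x + s *\<^sub>R X) + E x - s\<^sup>2 * k X\<bar> \<le> e / 2 * s\<^sup>2"
      by blast
    define s where "s = min d1 d2 / 2"
    have s: "0 < s" "s < d1" "s < d2" using d by (auto simp: s_def)
    have eq: "x + s *\<^sub>R Y + s *\<^sub>R X = x + s *\<^sub>R X + s *\<^sub>R Y" by simp
    have "\<bar>s\<^sup>2 * h Y - s\<^sup>2 * k X\<bar> \<le> e / 2 * s\<^sup>2 + e / 2 * s\<^sup>2"
      using d(3)[of s] d(4)[of s] s unfolding eq abs_le_iff by linarith
    moreover have "\<bar>h Y - k X\<bar> * s\<^sup>2 = \<bar>s\<^sup>2 * h Y - s\<^sup>2 * k X\<bar>"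
      by (simp add: abs_mult flip: right_diff_distrib)
    ultimately have "\<bar>h Y - k X\<bar> * s\<^sup>2 \<le> e * s\<^sup>2" by simp
    then show ?thesis using s by simp
  qed
  then have "\<bar>h Y - k X\<bar> \<le> 0" by (rule field_le_epsilon)
  then show ?thesis by simp
qed

section \<open>Derivatives of smooth maps\<close>

lemma frechet_derivative_basis_expansion:
  fixes f :: "'a::euclidean_space \<Rightarrow> 'b::real_normed_vector"
  assumes "f differentiable (at z)"
  shows "frechet_derivative f (at z) u = (\<Sum>b\<in>Basis. (u \<bullet> b) *\<^sub>R frechet_derivative f (at z) b)"
proof -
  interpret linear "frechet_derivative f (at z)"
    using assms by (rule linear_frechet_derivative)
  show ?thesis
    by (subst (1) euclidean_representation[symmetric, of u]) (simp add: sum scaleR)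
qed

lemma smooth_on_differentiable:
  assumes "smooth_on S f" "open S" "x \<in> S"
  shows "f differentiable (at x)"
proof -
  have "Ck_on (Suc 0) S f" using assms unfolding smooth_on_def by blast
  then show ?thesis using assms by (auto simp: differentiable_on_eq_differentiable_at)
qed

text \<open>\<open>Ck_on\<close> controls derivatives along \<open>Basis\<close> only; expanding
  \<open>u\<close> in the basis reaches every direction. The expansion is valid on all of
  \<open>S\<close>, whose openness lets the derivative pass through it.\<close>

lemma smooth_on_derivative_differentiable:
  fixes f :: "'a::euclidean_space \<Rightarrow> 'b::real_normed_vector"
  assumes "smooth_on S f" "open S" "x \<in> S"
  shows "(\<lambda>z. frechet_derivative f (at z) u) differentiable (at x)"
proof -
  have "Ck_on (Suc (Suc 0)) S f" using assms unfolding smooth_on_def by blast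
  then have D: "(\<lambda>z. frechet_derivative f (at z) b) differentiable (at x)" if "b \<in> Basis" for b
    using that assms by (auto simp: differentiable_on_eq_differentiable_at)
  have "(\<lambda>z. \<Sum>b\<in>Basis. (u \<bullet> b) *\<^sub>R frechet_derivative f (at z) b) differentiable (at x)"
    using D by (intro differentiable_sum) auto
  then obtain F where "((\<lambda>z. \<Sum>b\<in>Basis. (u \<bullet> b) *\<^sub>R frechet_derivative f (at z) b) has_derivative F) (at x)"
    unfolding differentiable_def by blast
  then have "((\<lambda>z. frechet_derivative f (at z) u) has_derivative F) (at x)"
    by (rule has_derivative_transform_within_open[OF _ \<open>open S\<close> \<open>x \<in> S\<close>])
      (simp flip: frechet_derivative_basis_expansion[OF smooth_on_differentiable[OF assms(1,2)]])
  then show ?thesis by (rule differentiableI)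
qed

section \<open>Differentiability of matrix expressions\<close>

lemma bounded_bilinear_matrix_vector_mult:
  "bounded_bilinear ((*v) :: real^'n^'m \<Rightarrow> real^'n \<Rightarrow> real^'m)"
  unfolding bilinear_conv_bounded_bilinear[symmetric] bilinear_def
  by (auto intro!: linearI simp: matrix_vector_mult_add_rdistrib matrix_vector_mult_def vec_eq_iff
      sum.distrib sum_distrib_left algebra_simps)

lemmas matrix_vector_mult_has_derivative =
  bounded_bilinear.FDERIV[OF bounded_bilinear_matrix_vector_mult]

lemma differentiable_bilinear:
  assumes "bounded_bilinear h" "f differentiable (at x within S)" "g differentiable (at x within S)"
  shows "(\<lambda>x. h (f x) (g x)) differentiable (at x within S)"
  using bounded_bilinear.FDERIV[OF assms(1)] assms(2,3)
  unfolding differentiable_def by blast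

lemma differentiable_prod:
  fixes f :: "'i \<Rightarrow> 'a::real_normed_vector \<Rightarrow> real"
  assumes "\<And>i. i \<in> I \<Longrightarrow> f i differentiable (at x within S)"
  shows "(\<lambda>x. \<Prod>i\<in>I. f i x) differentiable (at x within S)"
  using assms by (induction I rule: infinite_finite_induct) auto

text \<open>The component type is a general euclidean space, so that two uses lead from a matrix to
  its rows and on to its entries.\<close>

lemma differentiable_vec_nth_iff:
  fixes f :: "'a::real_normed_vector \<Rightarrow> 'b::euclidean_space^'n"
  shows "f differentiable (at x) \<longleftrightarrow> (\<forall>i. (\<lambda>z. f z $ i) differentiable (at x))"
  unfolding differentiable_componentwise_within[where f=f]
  by (subst differentiable_componentwise_within)
    (auto simp: Basis_vec_def inner_axis)

lemma frechet_derivative_vec_nth: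
  fixes f :: "'a::real_normed_vector \<Rightarrow> 'b::real_normed_vector^'n"
  assumes "f differentiable (at x)"
  shows "frechet_derivative (\<lambda>z. f z $ i) (at x) u = frechet_derivative f (at x) u $ i"
  using bounded_linear.has_derivative[OF bounded_linear_vec_nth assms[unfolded frechet_derivative_works]]
    frechet_derivative_at by metis

lemma matrix_inv_invertible:
  fixes M :: "real^'n^'n"
  assumes "invertible M"
  shows "M ** matrix_inv M = mat 1" "matrix_inv M ** M = mat 1"
  using someI_ex[OF assms[unfolded invertible_def]] unfolding matrix_inv_def by auto

text \<open>Cramer's rule displays the solution as a quotient of polynomials in the entries;
  differentiability of the raised covector is read off from this form.\<close>

lemma matrix_inv_mult_cramer:
  fixes M :: "real^'n^'n"
  assumes "invertible M"
  shows "matrix_inv M *v p = (\<chi> k. det (\<chi> i j. if j = k then p $ i else M $ i $ j) / det M)"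
proof -
  have "det M \<noteq> 0" using assms by (simp add: invertible_det_nz)
  moreover have "M *v (matrix_inv M *v p) = p"
    using assms by (simp add: matrix_vector_mul_assoc matrix_inv_invertible)
  ultimately show ?thesis by (simp add: cramer)
qed

lemma differentiable_det:
  fixes M :: "'a::real_normed_vector \<Rightarrow> real^'n^'n"
  assumes "\<And>i j. (\<lambda>z. M z $ i $ j) differentiable (at x)"
  shows "(\<lambda>z. det (M z)) differentiable (at x)"
  unfolding det_def using assms
  by (intro differentiable_sum ballI differentiable_mult differentiable_prod) auto

lemma linear_axis_expansion:
  fixes f :: "real^'n \<Rightarrow> 'b::real_vector"
  assumes "linear f"
  shows "f v = (\<Sum>i\<in>UNIV. v $ i *\<^sub>R f (axis i 1))"
proof -
  interpret linear f by fact
  have "f v = f (\<Sum>i\<in>UNIV. v $ i *\<^sub>R axis i 1)"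
    using basis_expansion[of v] by (simp add: scalar_mult_eq_scaleR)
  then show ?thesis by (simp add: sum scaleR)
qed

section \<open>The energy in a chart\<close>

text \<open>A metric in coordinates, as a matrix function on an open set of \<open>real^'n\<close>.
  All calculus with the energy and the connection is done here, away from charts and tangent
  vectors; in a pair \<open>z\<close> the first component is q and the second is p.\<close>

locale metric_on =
  fixes S :: "(real^'n) set" and gl :: "real^'n \<Rightarrow> real^'n^'n"
  assumes open_S: "open S"
    and metric_differentiable: "y \<in> S \<Longrightarrow> gl differentiable (at y)"
    and metric_derivative_differentiable:
      "y \<in> S \<Longrightarrow> (\<lambda>z. frechet_derivative gl (at z) u) differentiable (at y)"
    and symmetric: "y \<in> S \<Longrightarrow> transpose (gl y) = gl y"
    and positive: "y \<in> S \<Longrightarrow> v \<noteq> 0 \<Longrightarrow> v \<bullet> (gl y *v v) > 0"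
begin

abbreviation gu :: "real^'n \<Rightarrow> real^'n^'n" where "gu y \<equiv> matrix_inv (gl y)"

abbreviation dgl :: "real^'n \<Rightarrow> real^'n \<Rightarrow> real^'n^'n" where
  "dgl y u \<equiv> frechet_derivative gl (at y) u"

definition raised :: "(real^'n) \<times> (real^'n) \<Rightarrow> real^'n" where
  "raised z = gu (fst z) *v snd z"

definition energy :: "(real^'n) \<times> (real^'n) \<Rightarrow> real" where
  "energy z = (snd z \<bullet> raised z) / 2"

text \<open>With \<open>r\<close> the raised covector, differentiating \<open>g r = p\<close> gives \<open>p \<bullet> dr = r \<bullet> dp - r \<bullet> (dg) r\<close>.\<close>

definition denergy :: "(real^'n) \<times> (real^'n) \<Rightarrow> (real^'n) \<times> (real^'n) \<Rightarrow> real" where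
  "denergy z X = snd X \<bullet> raised z - (raised z \<bullet> (dgl (fst z) (fst X) *v raised z)) / 2"

lemma metric_invertible:
  assumes "y \<in> S" shows "invertible (gl y)"
proof -
  have "v = 0" if "gl y *v v = 0" for v
    using positive[OF assms, of v] that by auto
  then show ?thesis
    using invertible_left_inverse matrix_left_invertible_ker by blast
qed

lemma gl_gu: "y \<in> S \<Longrightarrow> gl y *v (gu y *v p) = p"
  and gu_gl: "y \<in> S \<Longrightarrow> gu y *v (gl y *v p) = p"
  using metric_invertible[of y] by (simp_all add: matrix_vector_mul_assoc matrix_inv_invertible)

lemma gl_raised: "fst z \<in> S \<Longrightarrow> gl (fst z) *v raised z = snd z"
  by (simp add: raised_def gl_gu)

lemma gl_self_adjoint: "y \<in> S \<Longrightarrow> (gl y *v u) \<bullet> v = u \<bullet> (gl y *v v)"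
  using symmetric by (metis dot_lmul_matrix inner_commute transpose_matrix_vector)

lemma gu_self_adjoint: "y \<in> S \<Longrightarrow> (gu y *v u) \<bullet> v = u \<bullet> (gu y *v v)"
  by (metis gl_gu gl_self_adjoint)

text \<open>Substituting p = g r turns p \<bullet> r into the positive definite form r \<bullet> g
  r.\<close>

lemma energy_nonneg:
  assumes "fst z \<in> S" shows "energy z \<ge> 0"
proof -
  have "snd z \<bullet> raised z = raised z \<bullet> (gl (fst z) *v raised z)"
    using gl_raised[OF assms] by (simp add: inner_commute)
  then show ?thesis
    using positive[OF assms, of "raised z"] by (cases "raised z = 0") (auto simp: energy_def)
qed

lemma energy_eq_0_iff:
  assumes "fst z \<in> S" shows "energy z = 0 \<longleftrightarrow> snd z = 0"
proof -
  have "snd z \<bullet> raised z = raised z \<bullet> (gl (fst z) *v raised z)"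
    using gl_raised[OF assms] by (simp add: inner_commute)
  then show ?thesis
    using positive[OF assms, of "raised z"] gl_raised[OF assms]
    by (cases "raised z = 0") (auto simp: energy_def)
qed

lemma open_domain: "open (S \<times> UNIV)"
  using open_S by (intro open_Times) auto

lemma metric_fst_differentiable:
  assumes "fst z \<in> S" shows "(\<lambda>z. gl (fst z)) differentiable (at z)"
  by (intro differentiable_compose[of gl fst z] metric_differentiable assms
      bounded_linear_imp_differentiable bounded_linear_fst)

text \<open>By Cramer's rule \<open>raised\<close> is a quotient of determinants with nonzero
  denominator. That formula is available over \<open>S\<close> only, hence the transfer along the
  open set \<open>S \<times> UNIV\<close>.\<close>

lemma raised_differentiable:
  assumes "fst z \<in> S" shows "raised differentiable (at z)"
proof -
  let ?C = "\<lambda>z. (\<chi> k. det (\<chi> i j. if j = k then snd z $ i else gl (fst z) $ i $ j) / det (gl (fst z)))"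
  have gl: "(\<lambda>z. gl (fst z) $ i $ j) differentiable (at z)" for i j
    using metric_fst_differentiable[OF assms] by (simp add: differentiable_vec_nth_iff)
  have snd: "(\<lambda>z. snd z $ i) differentiable (at z)" for i :: 'n
    by (intro linear_imp_differentiable linearI) auto
  have nz: "det (gl (fst z)) \<noteq> 0"
    using metric_invertible[OF assms] by (simp add: invertible_det_nz)
  have "?C differentiable (at z)"
    unfolding differentiable_vec_nth_iff vec_lambda_beta
  proof (intro allI differentiable_divide differentiable_det nz)
    fix k i j
    show "(\<lambda>z. (\<chi> i j. if j = k then snd z $ i else gl (fst z) $ i $ j) $ i $ j) differentiable (at z)"
      using gl snd by (cases "j = k") auto
  qed (rule gl)
  then obtain D where "(?C has_derivative D) (at z)" unfolding differentiable_def by blast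
  then have "(raised has_derivative D) (at z)"
    by (rule has_derivative_transform_within_open[OF _ open_domain])
      (use assms in \<open>auto simp: mem_Times_iff raised_def matrix_inv_mult_cramer metric_invertible\<close>)
  then show ?thesis by (rule differentiableI)
qed

lemma energy_has_derivative:
  assumes "fst z \<in> S" shows "(energy has_derivative denergy z) (at z)"
proof -
  obtain D where D: "(raised has_derivative D) (at z)"
    using raised_differentiable[OF assms] unfolding differentiable_def by blast
  have gl: "((\<lambda>z. gl (fst z)) has_derivative (\<lambda>X. dgl (fst z) (fst X))) (at z)"
    using metric_differentiable[OF assms]
    by (intro has_derivative_compose[where g=gl and f=fst and f'=fst])
      (auto simp: frechet_derivative_works intro!: bounded_linear_imp_has_derivative bounded_linear_fst)
  have "((\<lambda>z. gl (fst z) *v raised z) has_derivative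
      (\<lambda>X. gl (fst z) *v D X + dgl (fst z) (fst X) *v raised z)) (at z)"
    by (rule matrix_vector_mult_has_derivative[OF gl D])
  \<comment> \<open>The product g r is the projection to p, so uniqueness of derivatives determines
    the unknown derivative \<open>D\<close> of \<open>raised\<close> without differentiating the
    inverse matrix.\<close>
  then have "((snd :: (real^'n) \<times> (real^'n) \<Rightarrow> _) has_derivative (\<lambda>X. gl (fst z) *v D X + dgl (fst z) (fst X) *v raised z)) (at z)"
    by (rule has_derivative_transform_within_open[OF _ open_domain])
      (use assms in \<open>auto simp: mem_Times_iff gl_raised\<close>)
  from has_derivative_unique[OF this]
  have D_eq: "gl (fst z) *v D X + dgl (fst z) (fst X) *v raised z = snd X" for X
    using bounded_linear_imp_has_derivative[OF bounded_linear_snd] by (auto dest!: fun_cong)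
  have snd: "(snd has_derivative (snd :: (real^'n) \<times> (real^'n) \<Rightarrow> _)) (at z)"
    by (intro bounded_linear_imp_has_derivative bounded_linear_snd)
  have "snd z \<bullet> D X + snd X \<bullet> raised z = 2 * denergy z X" for X
  proof -
    have "snd z \<bullet> D X = raised z \<bullet> (gl (fst z) *v D X)"
      using gl_raised[OF assms] gl_self_adjoint[OF assms] by metis
    also have "\<dots> = raised z \<bullet> (snd X - dgl (fst z) (fst X) *v raised z)"
      by (simp flip: D_eq[of X])
    finally show ?thesis
      by (simp add: denergy_def inner_diff_right inner_commute)
  qed
  then have eq: "(\<lambda>X. (snd z \<bullet> D X + snd X \<bullet> raised z) / 2) = denergy z"
    by auto
  have "((\<lambda>z. (snd z \<bullet> raised z) / 2) has_derivative (\<lambda>X. (snd z \<bullet> D X + snd X \<bullet> raised z) / 2)) (at z)"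
    by (rule bounded_linear.has_derivative[OF bounded_linear_divide has_derivative_inner[OF snd D]])
  then show ?thesis unfolding eq energy_def[abs_def] .
qed

lemma denergy_differentiable:
  assumes "fst z \<in> S" shows "(\<lambda>z. denergy z X) differentiable (at z)"
proof -
  have "(\<lambda>z. dgl (fst z) (fst X)) differentiable (at z)"
    by (intro differentiable_compose[of "\<lambda>y. dgl y (fst X)" fst z] assms
        metric_derivative_differentiable bounded_linear_imp_differentiable bounded_linear_fst)
  from differentiable_bilinear[OF bounded_bilinear_matrix_vector_mult this raised_differentiable[OF assms]]
  have "(\<lambda>z. raised z \<bullet> (dgl (fst z) (fst X) *v raised z)) differentiable (at z)"
    by (rule differentiable_bilinear[OF bounded_bilinear_inner raised_differentiable[OF assms]])
  moreover have "(\<lambda>z. snd X \<bullet> raised z) differentiable (at z)"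
    by (rule differentiable_bilinear[OF bounded_bilinear_inner differentiable_const raised_differentiable[OF assms]])
  ultimately show ?thesis
    unfolding denergy_def by simp
qed

text \<open>This is d(dt) = 0, the symmetry of the second derivative of \<open>energy\<close>; it
  removes the second-order terms from the exterior derivative below.\<close>

lemma denergy_symmetric:
  assumes "fst z \<in> S"
  shows "frechet_derivative (\<lambda>z. denergy z X) (at z) Y = frechet_derivative (\<lambda>z. denergy z Y) (at z) X"
proof (rule symmetric_second_derivative[OF open_domain])
  show "z \<in> S \<times> UNIV" using assms by (simp add: mem_Times_iff)
  show "(energy has_derivative denergy w) (at w)" if "w \<in> S \<times> UNIV" for w
    using that energy_has_derivative by (simp add: mem_Times_iff)
qed (use denergy_differentiable[OF assms] in \<open>simp_all flip: frechet_derivative_works\<close>)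

end

section \<open>The 2-form \<lambda> \<omega> + \<mu> dt \<and> \<theta> and its exterior
  derivative\<close>

definition canonical_form :: "(real^'n) \<times> (real^'n) \<Rightarrow> (real^'n) \<times> (real^'n) \<Rightarrow> real" where
  "canonical_form X Y = snd X \<bullet> fst Y - snd Y \<bullet> fst X"

context metric_on
begin

text \<open>The form \<lambda> \<omega> + \<mu> dt \<and> \<theta> in coordinates:
  \<open>canonical_form\<close> is \<omega>, \<open>denergy z\<close> is dt, and
  \<open>snd z \<bullet> fst X\<close> is \<theta>(X).\<close>

definition Phi :: "(real \<Rightarrow> real) \<Rightarrow> (real \<Rightarrow> real) \<Rightarrow> (real^'n) \<times> (real^'n) \<Rightarrow>
    (real^'n) \<times> (real^'n) \<Rightarrow> (real^'n) \<times> (real^'n) \<Rightarrow> real" where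
  "Phi lam mu z X Y = lam (energy z) * canonical_form X Y +
     mu (energy z) * (denergy z X * (snd z \<bullet> fst Y) - denergy z Y * (snd z \<bullet> fst X))"

text \<open>The 3-form dt \<and> \<omega>, written as a cyclic sum since \<omega> is
  alternating.\<close>

definition denergy_wedge_canonical :: "(real^'n) \<times> (real^'n) \<Rightarrow> (real^'n) \<times> (real^'n) \<Rightarrow>
    (real^'n) \<times> (real^'n) \<Rightarrow> (real^'n) \<times> (real^'n) \<Rightarrow> real" where
  "denergy_wedge_canonical z X Y Z =
     denergy z X * canonical_form Y Z + denergy z Y * canonical_form Z X + denergy z Z * canonical_form X Y"

text \<open>On the zero section \<open>f\<close> has only a one-sided derivative. The chain rule is
  therefore applied within \<open>S \<times> UNIV\<close>, which \<open>energy\<close> maps into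
  \<open>{0..}\<close>; as this domain is open, the result is an ordinary derivative in
  \<open>z\<close>.\<close>

lemma energy_function_has_derivative:
  assumes z: "fst z \<in> S" and f: "(f has_real_derivative f') (at (energy z) within {0..})"
  shows "((\<lambda>z. f (energy z)) has_derivative (\<lambda>X. f' * denergy z X)) (at z)"
proof -
  have zS: "z \<in> S \<times> UNIV" using z by (simp add: mem_Times_iff)
  have "(energy has_derivative denergy z) (at z within S \<times> UNIV)"
    using energy_has_derivative[OF z] by (rule has_derivative_at_withinI)
  moreover have "(f has_derivative (*) f') (at (energy z) within energy ` (S \<times> UNIV))"
    using f[unfolded has_field_derivative_def] by (rule has_derivative_subset) (auto intro: energy_nonneg)
  ultimately have "((\<lambda>z. f (energy z)) has_derivative (\<lambda>X. f' * denergy z X)) (at z within S \<times> UNIV)"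
    by (intro has_derivative_in_compose[of energy "denergy z" z _ f "(*) f'"])
  then show ?thesis
    by (simp add: at_within_open[OF zS open_domain])
qed

context
  fixes lam mu :: "real \<Rightarrow> real" and z :: "(real^'n) \<times> (real^'n)" and lam' mu' :: real
  assumes z: "fst z \<in> S"
    and lam: "(lam has_real_derivative lam') (at (energy z) within {0..})"
    and mu: "(mu has_real_derivative mu') (at (energy z) within {0..})"
begin

lemma Phi_has_derivative:
  "((\<lambda>z. Phi lam mu z X Y) has_derivative (\<lambda>Z.
     lam' * denergy z Z * canonical_form X Y +
     (mu (energy z) *
       (denergy z X * (snd Z \<bullet> fst Y) + frechet_derivative (\<lambda>z. denergy z X) (at z) Z * (snd z \<bullet> fst Y)
        - (denergy z Y * (snd Z \<bullet> fst X) + frechet_derivative (\<lambda>z. denergy z Y) (at z) Z * (snd z \<bullet> fst X)))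
      + mu' * denergy z Z * (denergy z X * (snd z \<bullet> fst Y) - denergy z Y * (snd z \<bullet> fst X))))) (at z)"
proof -
  have d: "((\<lambda>z. denergy z X * (snd z \<bullet> fst Y)) has_derivative
      (\<lambda>Z. denergy z X * (snd Z \<bullet> fst Y) + frechet_derivative (\<lambda>z. denergy z X) (at z) Z * (snd z \<bullet> fst Y))) (at z)"
    for X Y
    by (rule has_derivative_mult[OF denergy_differentiable[OF z, unfolded frechet_derivative_works]
        has_derivative_inner_left[OF bounded_linear_imp_has_derivative[OF bounded_linear_snd]]])
  show ?thesis
    unfolding Phi_def
    by (rule has_derivative_add[OF has_derivative_mult_left[OF energy_function_has_derivative[OF z lam]]
      has_derivative_mult[OF energy_function_has_derivative[OF z mu] has_derivative_diff[OF d d]]])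
qed

text \<open>In the cyclic sum the \<open>mu'\<close> terms cancel because dt \<and> dt = 0, the
  second derivatives cancel by \<open>denergy_symmetric\<close>, and the derivative of \<theta>
  contributes - \<mu> dt \<and> \<omega>.\<close>

lemma Phi_exterior_derivative:
  "frechet_derivative (\<lambda>z. Phi lam mu z Y Z) (at z) X + frechet_derivative (\<lambda>z. Phi lam mu z Z X) (at z) Y +
   frechet_derivative (\<lambda>z. Phi lam mu z X Y) (at z) Z
   = (lam' - mu (energy z)) * denergy_wedge_canonical z X Y Z"
  unfolding frechet_derivative_at[OF Phi_has_derivative, symmetric]
    denergy_symmetric[OF z, of Y X] denergy_symmetric[OF z, of Z X] denergy_symmetric[OF z, of Z Y]
  by (simp add: denergy_wedge_canonical_def canonical_form_def algebra_simps)

end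

lemma denergy_wedge_canonical_nonzero:
  assumes z: "fst z \<in> S" and "energy z \<noteq> 0" and "CARD('n) > 1"
  obtains X Y Z where "denergy_wedge_canonical z X Y Z \<noteq> 0"
proof -
  have r: "raised z \<noteq> 0" using assms by (auto simp: energy_def)
  obtain v where v: "v \<noteq> 0" "orthogonal (raised z) v"
    using orthogonal_to_vector_exists[of "raised z"] assms(3) by auto
  \<comment> \<open>Two vertical vectors and one coordinate vector along q. Since \<open>v\<close>
    is orthogonal to \<open>raised z\<close>, dt kills \<open>(0, v)\<close>; since \<omega>
    vanishes on two vertical vectors, only dt(0, r) \<omega>((0, v), (v, 0)) survives.\<close>
  have "denergy_wedge_canonical z (0, raised z) (0, v) (v, 0) = (raised z \<bullet> raised z) * (v \<bullet> v)"
    using v by (simp add: denergy_wedge_canonical_def denergy_def canonical_form_def orthogonal_def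
        linear_0[OF linear_frechet_derivative[OF metric_differentiable[OF z]]] inner_commute)
  then show ?thesis using that r v by (metis inner_eq_zero_iff mult_eq_0_iff)
qed

section \<open>The Levi-Civita connection and horizontal lifts\<close>

definition Gamma :: "real^'n \<Rightarrow> 'n \<Rightarrow> 'n \<Rightarrow> 'n \<Rightarrow> real" where
  "Gamma y k i j = (1/2) * (\<Sum>l\<in>UNIV. gu y $ k $ l *
     (dgl y (axis i 1) $ j $ l + dgl y (axis j 1) $ i $ l - dgl y (axis l 1) $ i $ j))"

definition Gamma0 :: "(real^'n) \<times> (real^'n) \<Rightarrow> 'n \<Rightarrow> 'n \<Rightarrow> real" where
  "Gamma0 z i h = (\<Sum>k\<in>UNIV. snd z $ k * Gamma (fst z) k i h)"

text \<open>The p-component of the horizontal vector over \<open>u\<close>: the pair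
  \<open>(u, lift z u)\<close> is the combination of the frame vectors \<delta> with coefficients
  \<open>u\<close>.\<close>

definition lift :: "(real^'n) \<times> (real^'n) \<Rightarrow> real^'n \<Rightarrow> real^'n" where
  "lift z u = (\<chi> h. \<Sum>i\<in>UNIV. u $ i * Gamma0 z i h)"

definition vertical_part :: "(real^'n) \<times> (real^'n) \<Rightarrow> (real^'n) \<times> (real^'n) \<Rightarrow> real^'n" where
  "vertical_part z X = snd X - lift z (fst X)"

lemma linear_lift: "linear (lift z)"
  by (rule linearI) (auto simp: lift_def vec_eq_iff sum.distrib sum_distrib_left algebra_simps)

lemma lift_axis: "lift z (axis i 1) = (\<chi> h. Gamma0 z i h)"
  by (simp add: lift_def axis_def if_distrib[of "\<lambda>x. x * _"] cong: if_cong)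

lemma dgl_symmetric:
  assumes "y \<in> S" shows "dgl y u $ i $ j = dgl y u $ j $ i"
proof -
  have D: "(\<lambda>z. gl z $ i) differentiable (at y)" for i
    using metric_differentiable[OF assms] differentiable_vec_nth_iff by blast
  have entry: "dgl y u $ i $ j = frechet_derivative (\<lambda>z. gl z $ i $ j) (at y) u" for i j
    using frechet_derivative_vec_nth[OF metric_differentiable[OF assms], of i u]
      frechet_derivative_vec_nth[OF D, of i j u] by simp
  have "(\<lambda>z. gl z $ i $ j) differentiable (at y)"
    using D[of i] by (simp add: differentiable_vec_nth_iff[of "\<lambda>z. gl z $ i"])
  moreover have "gl z $ i $ j = gl z $ j $ i" if "z \<in> S" for z
    using symmetric[OF that] by (simp add: transpose_def vec_eq_iff)
  ultimately have "frechet_derivative (\<lambda>z. gl z $ i $ j) (at y) = frechet_derivative (\<lambda>z. gl z $ j $ i) (at y)"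
    by (intro frechet_derivative_transform_within_open[OF _ open_S assms]) auto
  then show ?thesis by (simp add: entry)
qed

text \<open>Torsion-freeness: exchanging the lower indices swaps the first two derivatives of the
  metric, and the third is symmetric in them.\<close>

lemma Gamma0_symmetric:
  assumes "fst z \<in> S" shows "Gamma0 z i j = Gamma0 z j i"
proof -
  have "Gamma (fst z) k i j = Gamma (fst z) k j i" for k
    unfolding Gamma_def dgl_symmetric[OF assms, of _ i j] by (simp only: add.commute)
  then show ?thesis by (simp add: Gamma0_def)
qed

lemma lift_symmetric:
  assumes "fst z \<in> S" shows "lift z u \<bullet> v = lift z v \<bullet> u"
proof -
  have "lift z u \<bullet> v = (\<Sum>h\<in>UNIV. \<Sum>i\<in>UNIV. u $ i * Gamma0 z i h * v $ h)"
    by (simp add: inner_vec_def lift_def sum_distrib_right)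
  also have "\<dots> = (\<Sum>i\<in>UNIV. \<Sum>h\<in>UNIV. u $ i * Gamma0 z i h * v $ h)"
    by (rule sum.swap)
  also have "\<dots> = lift z v \<bullet> u"
    by (simp add: inner_vec_def lift_def sum_distrib_left Gamma0_symmetric[OF assms] mult_ac)
  finally show ?thesis .
qed

text \<open>Self-adjointness of the inverse metric exchanges its indices, which brings
  \<open>raised\<close> to the index order of \<open>raised_coeff\<close> and of the Christoffel
  symbols.\<close>

lemma raised_component:
  assumes "fst z \<in> S"
  shows "raised z $ l = (\<Sum>k\<in>UNIV. snd z $ k * gu (fst z) $ k $ l)"
proof -
  have "raised z $ l = raised z \<bullet> axis l 1" by (simp add: inner_axis)
  also have "\<dots> = snd z \<bullet> (gu (fst z) *v axis l 1)"
    by (simp add: raised_def gu_self_adjoint[OF assms])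
  finally show ?thesis
    by (simp add: inner_vec_def matrix_vector_mult_basis column_def)
qed

lemma dgl_expand:
  assumes "y \<in> S" shows "dgl y u $ h $ l = (\<Sum>i\<in>UNIV. u $ i * dgl y (axis i 1) $ h $ l)"
  using linear_axis_expansion[OF linear_frechet_derivative[OF metric_differentiable[OF assms]], of u] by simp

text \<open>Metric compatibility: by the next lemma \<^const>\<open>denergy\<close> vanishes on horizontal vectors.\<close>

lemma raised_inner_lift:
  assumes z: "fst z \<in> S"
  shows "raised z \<bullet> lift z u = (raised z \<bullet> (dgl (fst z) u *v raised z)) / 2"
proof -
  let ?r = "raised z" and ?D = "\<lambda>i. dgl (fst z) (axis i 1)"
  \<comment> \<open>Contracting p with the inverse metric in the Christoffel symbols leaves
    components of the raised covector.\<close>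
  have c0: "Gamma0 z i h = (\<Sum>l\<in>UNIV. ?r $ l * (?D i $ h $ l + ?D h $ i $ l - ?D l $ i $ h)) / 2" for i h
  proof -
    have "Gamma0 z i h = (\<Sum>k\<in>UNIV. \<Sum>l\<in>UNIV. snd z $ k * gu (fst z) $ k $ l *
      (?D i $ h $ l + ?D h $ i $ l - ?D l $ i $ h)) / 2"
      by (simp add: Gamma0_def Gamma_def sum_distrib_left sum_divide_distrib mult_ac)
    also have "\<dots> = (\<Sum>l\<in>UNIV. \<Sum>k\<in>UNIV. snd z $ k * gu (fst z) $ k $ l *
      (?D i $ h $ l + ?D h $ i $ l - ?D l $ i $ h)) / 2"
      by (subst sum.swap) simp
    finally show ?thesis by (simp add: raised_component[OF z] sum_distrib_right)
  qed
  \<comment> \<open>The factor \<open>?r $ h * ?r $ l\<close> is symmetric in \<open>h\<close> and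
    \<open>l\<close>, and the difference is antisymmetric; of the three Christoffel terms only the
    derivative in direction \<open>i\<close> remains.\<close>
  have cancel: "(\<Sum>h\<in>UNIV. \<Sum>l\<in>UNIV. ?r $ h * ?r $ l * (?D h $ i $ l - ?D l $ i $ h)) = 0" for i
  proof -
    have "(\<Sum>h\<in>UNIV. \<Sum>l\<in>UNIV. ?r $ h * ?r $ l * ?D h $ i $ l) =
      (\<Sum>h\<in>UNIV. \<Sum>l\<in>UNIV. ?r $ h * ?r $ l * ?D l $ i $ h)"
      by (subst sum.swap) (simp add: mult_ac)
    then show ?thesis by (simp add: right_diff_distrib sum_subtractf)
  qed
  have contract: "(\<Sum>h\<in>UNIV. ?r $ h * Gamma0 z i h) = (\<Sum>h\<in>UNIV. \<Sum>l\<in>UNIV. ?r $ h * ?r $ l * ?D i $ h $ l) / 2" for i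
  proof -
    have "(\<Sum>h\<in>UNIV. ?r $ h * Gamma0 z i h) =
      ((\<Sum>h\<in>UNIV. \<Sum>l\<in>UNIV. ?r $ h * ?r $ l * ?D i $ h $ l) +
       (\<Sum>h\<in>UNIV. \<Sum>l\<in>UNIV. ?r $ h * ?r $ l * (?D h $ i $ l - ?D l $ i $ h))) / 2"
      by (simp add: c0 sum_distrib_left flip: sum.distrib sum_divide_distrib) (simp add: algebra_simps)
    then show ?thesis by (simp add: cancel)
  qed
  have "?r \<bullet> lift z u = (\<Sum>h\<in>UNIV. \<Sum>i\<in>UNIV. u $ i * (?r $ h * Gamma0 z i h))"
    by (simp add: inner_vec_def lift_def sum_distrib_left mult_ac)
  also have "\<dots> = (\<Sum>i\<in>UNIV. u $ i * (\<Sum>h\<in>UNIV. ?r $ h * Gamma0 z i h))"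
    by (subst sum.swap) (simp add: sum_distrib_left)
  also have "\<dots> = (\<Sum>i\<in>UNIV. \<Sum>h\<in>UNIV. \<Sum>l\<in>UNIV. ?r $ h * ?r $ l * (u $ i * ?D i $ h $ l)) / 2"
    by (simp add: contract sum_distrib_left sum_divide_distrib mult_ac)
  \<comment> \<open>The sum over \<open>i\<close> is moved innermost, where it reassembles the
    derivative in direction \<open>u\<close>.\<close>
  also have "\<dots> = (\<Sum>h\<in>UNIV. \<Sum>l\<in>UNIV. \<Sum>i\<in>UNIV. ?r $ h * ?r $ l * (u $ i * ?D i $ h $ l)) / 2"
    by (subst sum.swap, subst (2) sum.swap) simp
  also have "\<dots> = (?r \<bullet> (dgl (fst z) u *v ?r)) / 2"
    by (simp add: inner_vec_def matrix_vector_mult_def dgl_expand[OF z, of u] sum_distrib_left sum_distrib_right mult_ac)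
  finally show ?thesis .
qed

lemma denergy_eq_vertical_part:
  assumes "fst z \<in> S" shows "denergy z X = raised z \<bullet> vertical_part z X"
  using raised_inner_lift[OF assms, of "fst X"]
  by (simp add: denergy_def vertical_part_def inner_diff_right inner_commute)

lemma canonical_form_eq_vertical_part:
  assumes "fst z \<in> S" shows "canonical_form X Y = vertical_part z X \<bullet> fst Y - vertical_part z Y \<bullet> fst X"
  using lift_symmetric[OF assms, of "fst X" "fst Y"]
  by (simp add: canonical_form_def vertical_part_def inner_diff_left)

end

section \<open>Tangent vectors in charts\<close>

text \<open>No topology on the points is assumed, only conditions on chart images and transitions.
  The locale thus serves both for the manifold and for its cotangent bundle.\<close>

locale C1_atlas =
  fixes A :: "('m, 'e::euclidean_space) chart set"
  assumes inj: "c \<in> A \<Longrightarrow> inj_on (snd c) (fst c)"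
    and open_overlap: "c \<in> A \<Longrightarrow> d \<in> A \<Longrightarrow> open (snd c ` (fst c \<inter> fst d))"
    and transition_differentiable: "c \<in> A \<Longrightarrow> d \<in> A \<Longrightarrow> x \<in> fst c \<Longrightarrow> x \<in> fst d \<Longrightarrow>
      transition c d differentiable (at (snd c x))"
begin

lemma chart_inv_chart: "c \<in> A \<Longrightarrow> x \<in> fst c \<Longrightarrow> chart_inv c (snd c x) = x"
  unfolding chart_inv_def by (rule inv_into_f_f[OF inj])

lemma transition_chart: "c \<in> A \<Longrightarrow> x \<in> fst c \<Longrightarrow> transition c d (snd c x) = snd d x"
  by (simp add: transition_def chart_inv_chart)

text \<open>Injectivity of the chart makes the image of the intersection the intersection of two
  open images. This is the neighbourhood on which the cocycle identity for transitions
  holds.\<close>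

lemma open_triple_overlap:
  assumes "c \<in> A" "d \<in> A" "e \<in> A"
  shows "open (snd c ` (fst c \<inter> fst d \<inter> fst e))"
proof -
  have "snd c ` (fst c \<inter> fst d \<inter> fst e) = snd c ` (fst c \<inter> fst d) \<inter> snd c ` (fst c \<inter> fst e)"
    using inj[OF assms(1)] by (auto simp: inj_on_def image_iff)
  then show ?thesis using assms by (simp add: open_Int open_overlap)
qed

lemma frechet_derivative_transition_self:
  assumes "c \<in> A" "x \<in> fst c"
  shows "frechet_derivative (transition c c) (at (snd c x)) u = u"
proof -
  have "frechet_derivative (\<lambda>y. y) (at (snd c x)) = frechet_derivative (transition c c) (at (snd c x))"
    by (rule frechet_derivative_transform_within_open[OF _ open_overlap[OF assms(1,1)]])
      (use assms in \<open>auto simp: transition_chart\<close>)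
  then show ?thesis by (metis frechet_derivative_ident)
qed

text \<open>The chain rule, since near the point the transition from \<open>c\<close> to
  \<open>e\<close> factors through \<open>d\<close>. This cocycle identity makes
  \<open>chart_vector\<close> a compatible family of components.\<close>

lemma frechet_derivative_transition_transition:
  assumes "c \<in> A" "d \<in> A" "e \<in> A" and "x \<in> fst c" "x \<in> fst d" "x \<in> fst e"
  shows "frechet_derivative (transition d e) (at (snd d x)) (frechet_derivative (transition c d) (at (snd c x)) u)
    = frechet_derivative (transition c e) (at (snd c x)) u"
proof -
  have "frechet_derivative (transition d e \<circ> transition c d) (at (snd c x)) =
      frechet_derivative (transition d e) (at (transition c d (snd c x))) \<circ>
      frechet_derivative (transition c d) (at (snd c x))"
    using assms by (intro frechet_derivative_compose) (auto simp: transition_chart transition_differentiable)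
  moreover have "frechet_derivative (transition c e) (at (snd c x)) =
      frechet_derivative (transition d e \<circ> transition c d) (at (snd c x))"
    by (rule frechet_derivative_transform_within_open[OF _ open_triple_overlap[OF assms(1-3)]])
      (use assms in \<open>auto simp: transition_chart transition_differentiable\<close>)
  ultimately show ?thesis using assms by (simp add: transition_chart)
qed

lemma chart_vector_in_tangent_space:
  assumes "c \<in> A" "x \<in> fst c"
  shows "chart_vector A x c u \<in> tangent_space A x"
proof -
  have "chart_vector A x c u e = frechet_derivative (transition d e) (at (snd d x)) (chart_vector A x c u d)"
    if "d \<in> charts_at A x" "e \<in> charts_at A x" for d e
    using that assms frechet_derivative_transition_transition[of c d e x u]
    by (simp add: chart_vector_def charts_at_def)
  moreover have "chart_vector A x c u d = 0" if "d \<notin> charts_at A x" for d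
    using that by (simp add: chart_vector_def)
  ultimately show ?thesis unfolding tangent_space_def by blast
qed

lemma chart_vector_apply:
  assumes "d \<in> A" "x \<in> fst d"
  shows "chart_vector A x c u d = frechet_derivative (transition c d) (at (snd c x)) u"
  using assms by (simp add: chart_vector_def charts_at_def)

lemma chart_vector_self:
  assumes "c \<in> A" "x \<in> fst c"
  shows "chart_vector A x c u c = u"
  using assms by (simp add: chart_vector_apply frechet_derivative_transition_self)

text \<open>The component in one chart determines all others, so statements about the tangent space
  reduce to vectors of the model space.\<close>

lemma tangent_vector_eq_chart_vector:
  assumes "c \<in> A" "x \<in> fst c" "v \<in> tangent_space A x"
  shows "v = chart_vector A x c (v c)"
proof
  fix d
  have c: "c \<in> charts_at A x" using assms by (simp add: charts_at_def)
  show "v d = chart_vector A x c (v c) d"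
  proof (cases "d \<in> charts_at A x")
    case True
    then have "v d = frechet_derivative (transition c d) (at (snd c x)) (v c)"
      using assms(3) c unfolding tangent_space_def by blast
    then show ?thesis using True by (simp only: chart_vector_def if_True)
  next
    case False
    then have "v d = 0" using assms(3) unfolding tangent_space_def by blast
    then show ?thesis using False by (simp only: chart_vector_def if_False)
  qed
qed

lemma linear_chart_vector:
  assumes "c \<in> A" "x \<in> fst c"
  shows "linear (\<lambda>u. chart_vector A x c u d)"
proof (cases "d \<in> charts_at A x")
  case True
  then show ?thesis
    using linear_frechet_derivative[OF transition_differentiable[OF assms(1) _ assms(2)]]
    by (simp add: chart_vector_def charts_at_def)
next
  case False
  then show ?thesis by (simp add: chart_vector_def linear_zero)
qed

lemma chart_vector_combination:
  assumes "c \<in> A" "x \<in> fst c"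
  shows "(\<lambda>d. r *\<^sub>R chart_vector A x c u d + s *\<^sub>R chart_vector A x c v d)
    = chart_vector A x c (r *\<^sub>R u + s *\<^sub>R v)"
proof
  fix d
  interpret linear "\<lambda>u. chart_vector A x c u d" by (rule linear_chart_vector[OF assms])
  show "r *\<^sub>R chart_vector A x c u d + s *\<^sub>R chart_vector A x c v d = chart_vector A x c (r *\<^sub>R u + s *\<^sub>R v) d"
    by (simp add: add scaleR)
qed

text \<open>The inner map \<open>L\<close> allows restriction to subspaces of the model space, such
  as the horizontal and the vertical one.\<close>

lemma linear_form_on_chart_vector:
  assumes f: "linear_form_on (tangent_space A x) f" and c: "c \<in> A" "x \<in> fst c" and L: "linear L"
  shows "linear (\<lambda>u. f (chart_vector A x c (L u)))"
proof -
  have comb: "f (chart_vector A x c (r *\<^sub>R u + s *\<^sub>R v)) =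
      r * f (chart_vector A x c u) + s * f (chart_vector A x c v)" for r s u v
    unfolding chart_vector_combination[OF c, symmetric]
    using f chart_vector_in_tangent_space[OF c] unfolding linear_form_on_def by blast
  show ?thesis
    using comb[of 1 _ 1] comb[of _ _ 0 0]
    by (intro linearI) (simp_all add: linear_add[OF L] linear_cmul[OF L])
qed

end

lemma transition_smooth:
  assumes "smooth_atlas A" "c \<in> A" "d \<in> A"
  shows "smooth_on (snd c ` (fst c \<inter> fst d)) (transition c d)"
  using assms by (simp add: smooth_atlas_def)

lemma smooth_atlas_C1_atlas:
  assumes "smooth_atlas A" shows "C1_atlas A"
proof
  fix c assume c: "c \<in> A"
  then have hom: "homeomorphism (fst c) (snd c ` fst c) (snd c) (chart_inv c)"
    and op: "open (snd c ` fst c)"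
    using assms by (auto simp: smooth_atlas_def)
  show "inj_on (snd c) (fst c)"
    using hom by (metis homeomorphism_def inj_on_inverseI)
  fix d assume d: "d \<in> A"
  have "openin (top_of_set (fst c)) (fst c \<inter> fst d)"
    using assms d by (intro openin_open_Int) (auto simp: smooth_atlas_def)
  then have "openin (top_of_set (snd c ` fst c)) (snd c ` (fst c \<inter> fst d))"
    by (rule homeomorphism_imp_open_map[OF hom])
  then show ov: "open (snd c ` (fst c \<inter> fst d))"
    using op openin_open_trans by blast
  show "transition c d differentiable (at (snd c x))" if "x \<in> fst c" "x \<in> fst d" for x
    using smooth_on_differentiable[OF transition_smooth[OF assms c d] ov] that by blast
qed

section \<open>Charts of the cotangent bundle\<close>

text \<open>The inverse of taking components in the chart \<open>c\<close>; the value 0 off the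
  tangent space is the normalisation required by \<open>cotangent_space\<close>.\<close>

definition covector_of ::
  "('m, real^'n) chart set \<Rightarrow> ('m, real^'n) chart \<Rightarrow> 'm \<Rightarrow> real^'n \<Rightarrow> ('m, 'n) covector" where
  "covector_of A c x p = (\<lambda>v. if v \<in> tangent_space A x then v c \<bullet> p else 0)"

locale smooth_manifold =
  fixes A :: "('m::{t2_space,second_countable_topology}, real^'n) chart set"
  assumes smooth_atlas: "smooth_atlas A"
begin

sublocale C1_atlas A using smooth_atlas by (rule smooth_atlas_C1_atlas)

lemma covector_of_in_cotangent_space:
  assumes c: "c \<in> A" "x \<in> fst c"
  shows "covector_of A c x p \<in> cotangent_space A x"
proof -
  \<comment> \<open>The case distinction in \<open>covector_of\<close> makes linearity depend on the
    tangent space being closed under combinations.\<close>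
  have comb: "(\<lambda>c. r *\<^sub>R v c + s *\<^sub>R w c) \<in> tangent_space A x"
    if "v \<in> tangent_space A x" "w \<in> tangent_space A x" for v w r s
    by (subst tangent_vector_eq_chart_vector[OF c that(1)], subst tangent_vector_eq_chart_vector[OF c that(2)])
      (simp add: chart_vector_combination[OF c] chart_vector_in_tangent_space[OF c])
  then show ?thesis
    by (auto simp: cotangent_space_def linear_form_on_def covector_of_def inner_add_left)
qed

lemma covector_eq_covector_of:
  assumes c: "c \<in> A" "x \<in> fst c" and p: "p \<in> cotangent_space A x"
  shows "p = covector_of A c x (covector_coeff A c (x, p))"
proof
  fix v
  have f: "linear_form_on (tangent_space A x) p" and 0: "v \<notin> tangent_space A x \<Longrightarrow> p v = 0"
    using p by (simp_all add: cotangent_space_def)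
  have *: "p (chart_vector A x c u) = u \<bullet> covector_coeff A c (x, p)" for u
    using linear_axis_expansion[OF linear_form_on_chart_vector[OF f c linear_ident], of u]
    by (simp add: inner_vec_def covector_coeff_def)
  show "p v = covector_of A c x (covector_coeff A c (x, p)) v"
    using *[of "v c"] tangent_vector_eq_chart_vector[OF c, of v] 0 by (auto simp: covector_of_def)
qed

lemma covector_coeff_covector_of:
  assumes c: "c \<in> A" "x \<in> fst c" and d: "d \<in> A" "x \<in> fst d"
  shows "covector_coeff A d (x, covector_of A c x p) =
    (\<chi> i. frechet_derivative (transition d c) (at (snd d x)) (basis_vec i) \<bullet> p)"
proof -
  have "covector_of A c x p (chart_vector A x d u) =
      frechet_derivative (transition d c) (at (snd d x)) u \<bullet> p" for u
    by (simp only: covector_of_def chart_vector_in_tangent_space[OF d] chart_vector_apply[OF c] if_True)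
  then show ?thesis by (simp only: covector_coeff_def fst_conv snd_conv)
qed

lemma covector_coeff_covector_of_self:
  assumes c: "c \<in> A" "x \<in> fst c"
  shows "covector_coeff A c (x, covector_of A c x p) = p"
  unfolding covector_coeff_covector_of[OF c c] frechet_derivative_transition_self[OF c]
  by (simp only: vec_eq_iff inner_axis') simp

lemma cotangent_chart_point:
  assumes c: "c \<in> A" "x \<in> fst c"
  shows "(x, covector_of A c x p) \<in> fst (cotangent_chart A c)"
    and "snd (cotangent_chart A c) (x, covector_of A c x p) = (snd c x, p)"
  using c by (simp_all add: cotangent_chart_def cotangent_bundle_def covector_of_in_cotangent_space
      covector_coeff_covector_of_self)

lemma cotangent_chart_pointE:
  assumes "c \<in> A" "\<xi> \<in> fst (cotangent_chart A c)"
  obtains x p where "x \<in> fst c" "\<xi> = (x, covector_of A c x p)"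
proof
  show "fst \<xi> \<in> fst c" using assms(2) by (simp add: cotangent_chart_def)
  have "snd \<xi> \<in> cotangent_space A (fst \<xi>)"
    using assms(2) by (simp add: cotangent_chart_def cotangent_bundle_def split_beta)
  from covector_eq_covector_of[OF assms(1) \<open>fst \<xi> \<in> fst c\<close> this]
  show "\<xi> = (fst \<xi>, covector_of A c (fst \<xi>) (covector_coeff A c \<xi>))"
    by (intro prod_eqI) simp_all
qed

lemma cotangent_chart_overlap:
  assumes c: "c \<in> A" and d: "d \<in> A"
  shows "snd (cotangent_chart A c) ` (fst (cotangent_chart A c) \<inter> fst (cotangent_chart A d))
    = snd c ` (fst c \<inter> fst d) \<times> UNIV"
proof -
  have "(snd c x, p) \<in> snd (cotangent_chart A c) ` (fst (cotangent_chart A c) \<inter> fst (cotangent_chart A d))"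
    if x: "x \<in> fst c" "x \<in> fst d" for x p
    using cotangent_chart_point[OF c x(1), of p] x(2)
    by (intro image_eqI[of _ _ "(x, covector_of A c x p)"]) (auto simp: cotangent_chart_def)
  then show ?thesis by (auto simp: cotangent_chart_def)
qed

lemma cotangent_chart_image:
  assumes "c \<in> A"
  shows "snd (cotangent_chart A c) ` fst (cotangent_chart A c) = snd c ` fst c \<times> UNIV"
  using cotangent_chart_overlap[OF assms assms] by simp

lemma inj_cotangent_chart:
  assumes c: "c \<in> A"
  shows "inj_on (snd (cotangent_chart A c)) (fst (cotangent_chart A c))"
proof (rule inj_onI)
  fix \<xi> \<eta>
  assume "\<xi> \<in> fst (cotangent_chart A c)" "\<eta> \<in> fst (cotangent_chart A c)"
    and eq: "snd (cotangent_chart A c) \<xi> = snd (cotangent_chart A c) \<eta>"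
  then obtain x p y q where "x \<in> fst c" "\<xi> = (x, covector_of A c x p)" "y \<in> fst c" "\<eta> = (y, covector_of A c y q)"
    using cotangent_chart_pointE[OF c] by metis
  then show "\<xi> = \<eta>"
    using eq cotangent_chart_point(2)[OF c] inj_onD[OF inj[OF c]] by auto
qed

lemma chart_inv_cotangent_chart:
  assumes c: "c \<in> A" "x \<in> fst c"
  shows "chart_inv (cotangent_chart A c) (snd c x, p) = (x, covector_of A c x p)"
  using inv_into_f_f[OF inj_cotangent_chart[OF c(1)] cotangent_chart_point(1)[OF c]]
  by (simp add: chart_inv_def cotangent_chart_point(2)[OF c])

text \<open>Covectors transform contragrediently: the fibre part uses the Jacobian of the reverse
  transition, taken at the image point.\<close>

lemma cotangent_transition:
  assumes c: "c \<in> A" and d: "d \<in> A" and x: "x \<in> fst c" "x \<in> fst d"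
  shows "transition (cotangent_chart A c) (cotangent_chart A d) (snd c x, p) =
    (transition c d (snd c x),
     \<chi> i. frechet_derivative (transition d c) (at (transition c d (snd c x))) (basis_vec i) \<bullet> p)"
  using assms
  by (simp add: transition_def[of "cotangent_chart A c"] chart_inv_cotangent_chart transition_chart)
    (simp add: cotangent_chart_def covector_coeff_covector_of)

text \<open>The fibre part contains first derivatives of \<open>transition d c\<close>, so
  second-order smoothness of the atlas of the base enters here.\<close>

lemma cotangent_transition_differentiable:
  assumes c: "c \<in> A" and d: "d \<in> A" and x: "x \<in> fst c" "x \<in> fst d"
  shows "transition (cotangent_chart A c) (cotangent_chart A d) differentiable (at (snd c x, p))"
proof -
  let ?T = "\<lambda>z. (transition c d (fst z),
     \<chi> i. frechet_derivative (transition d c) (at (transition c d (fst z))) (basis_vec i) \<bullet> snd z)"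
  let ?z = "(snd c x, p)"
  have T: "(\<lambda>z. transition c d (fst z)) differentiable (at ?z)"
    using transition_differentiable[OF c d x]
    by (intro differentiable_compose[of "transition c d" fst])
      (auto intro: bounded_linear_imp_differentiable bounded_linear_fst)
  have D: "(\<lambda>y. frechet_derivative (transition d c) (at y) (basis_vec i)) differentiable (at (snd d x))" for i
    using smooth_on_derivative_differentiable[OF transition_smooth[OF smooth_atlas d c]
        open_overlap[OF d c]] x by blast
  have "(\<lambda>z. frechet_derivative (transition d c) (at (transition c d (fst z))) (basis_vec i)) differentiable (at ?z)" for i
    using D[of i] x c
    by (intro differentiable_compose[OF _ T]) (simp add: transition_chart)
  then have "(\<lambda>z. frechet_derivative (transition d c) (at (transition c d (fst z))) (basis_vec i) \<bullet> snd z)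
      differentiable (at ?z)" for i
    by (intro differentiable_bilinear[OF bounded_bilinear_inner])
      (auto intro: bounded_linear_imp_differentiable bounded_linear_snd)
  then have "(\<lambda>z. \<chi> i. frechet_derivative (transition d c) (at (transition c d (fst z))) (basis_vec i) \<bullet> snd z)
      differentiable (at ?z)"
    unfolding differentiable_vec_nth_iff by simp
  with T obtain F1 F2 where "((\<lambda>z. transition c d (fst z)) has_derivative F1) (at ?z)"
    "((\<lambda>z. \<chi> i. frechet_derivative (transition d c) (at (transition c d (fst z))) (basis_vec i) \<bullet> snd z)
      has_derivative F2) (at ?z)"
    unfolding differentiable_def by blast
  then have "(?T has_derivative (\<lambda>h. (F1 h, F2 h))) (at ?z)" by (rule has_derivative_Pair)
  moreover have "open (snd c ` (fst c \<inter> fst d) \<times> (UNIV :: (real^'n) set))"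
    using open_overlap[OF c d] by (intro open_Times) auto
  ultimately have "(transition (cotangent_chart A c) (cotangent_chart A d) has_derivative (\<lambda>h. (F1 h, F2 h))) (at ?z)"
    by (rule has_derivative_transform_within_open)
      (use x c d in \<open>auto simp: cotangent_transition\<close>)
  then show ?thesis by (rule differentiableI)
qed

lemma cotangent_atlas_C1_atlas: "C1_atlas (cotangent_atlas A)"
proof
  fix C assume "C \<in> cotangent_atlas A"
  then obtain c where c: "c \<in> A" and C: "C = cotangent_chart A c" by (auto simp: cotangent_atlas_def)
  show "inj_on (snd C) (fst C)" unfolding C by (rule inj_cotangent_chart[OF c])
  fix D assume "D \<in> cotangent_atlas A"
  then obtain d where d: "d \<in> A" and D: "D = cotangent_chart A d" by (auto simp: cotangent_atlas_def)
  show "open (snd C ` (fst C \<inter> fst D))"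
    unfolding C D cotangent_chart_overlap[OF c d]
    using open_overlap[OF c d] by (intro open_Times) auto
  fix \<xi> assume \<xi>: "\<xi> \<in> fst C" "\<xi> \<in> fst D"
  then obtain x p where xp: "x \<in> fst c" "\<xi> = (x, covector_of A c x p)"
    using cotangent_chart_pointE[OF c] unfolding C by blast
  moreover have "x \<in> fst d" using \<xi>(2) xp by (auto simp: D cotangent_chart_def)
  ultimately show "transition C D differentiable (at (snd C \<xi>))"
    using cotangent_transition_differentiable[OF c d] cotangent_chart_point(2)[OF c] by (simp add: C D)
qed

end

section \<open>Forms and endomorphisms determined on a frame\<close>

lemma linear_eq_axis:
  fixes f g :: "real^'n \<Rightarrow> 'b::real_vector"
  assumes "linear f" "linear g" and "\<And>i. f (axis i 1) = g (axis i 1)"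
  shows "f v = g v"
  unfolding linear_axis_expansion[OF assms(1), of v] linear_axis_expansion[OF assms(2), of v] assms(3) ..

lemma bilinear_eq_axis:
  fixes f g :: "real^'n \<Rightarrow> real^'n \<Rightarrow> real"
  assumes f: "bilinear f" and g: "bilinear g" and eq: "\<And>i j. f (axis i 1) (axis j 1) = g (axis i 1) (axis j 1)"
  shows "f u v = g u v"
proof (rule linear_eq_axis[of "f u" "g u"])
  show "linear (f u)" "linear (g u)" using f g by (auto simp: bilinear_def)
  show "f u (axis j 1) = g u (axis j 1)" for j
    by (rule linear_eq_axis[of "\<lambda>u. f u (axis j 1)" "\<lambda>u. g u (axis j 1)"])
      (use f g eq in \<open>auto simp: bilinear_def\<close>)
qed

lemma axis_inner_matrix_axis:
  fixes M :: "real^'n^'n"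
  shows "axis i 1 \<bullet> (M *v axis j 1) = M $ i $ j"
  by (simp add: matrix_vector_mult_basis column_def inner_axis')

text \<open>The common shape of \<open>G\<close> on horizontal and on vertical vectors.\<close>

lemma bilinear_matrix_form:
  fixes M :: "real^'n^'n"
  shows "bilinear (\<lambda>u v. c * (u \<bullet> (M *v v)) + d * (p \<bullet> u) * (p \<bullet> v))"
  unfolding bilinear_def
  by (intro conjI allI linearI)
    (simp_all add: matrix_vector_right_distrib matrix_vector_mult_scaleR inner_add_left inner_add_right algebra_simps)

context C1_atlas
begin

lemma linear_form_on_sym:
  assumes "symmetric_bilinear_form_on (tangent_space A x) b" "v \<in> tangent_space A x"
  shows "linear_form_on (tangent_space A x) (b v)"
  using assms by (simp add: symmetric_bilinear_form_on_def)

text \<open>\<open>symmetric_bilinear_form_on\<close> states linearity in the second argument only;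
  symmetry carries it to the first. Separate maps \<open>L\<close> and \<open>K\<close> also cover
  the mixed horizontal-vertical case.\<close>

lemma bilinear_chart_vector:
  assumes b: "symmetric_bilinear_form_on (tangent_space A x) b" and c: "c \<in> A" "x \<in> fst c"
    and L: "linear L" and K: "linear K"
  shows "bilinear (\<lambda>u v. b (chart_vector A x c (L u)) (chart_vector A x c (K v)))"
proof -
  have sym: "b (chart_vector A x c (L u)) (chart_vector A x c (K v)) =
      b (chart_vector A x c (K v)) (chart_vector A x c (L u))" for u v
    using b chart_vector_in_tangent_space[OF c] by (simp add: symmetric_bilinear_form_on_def)
  have lin: "linear (\<lambda>v. b (chart_vector A x c u) (chart_vector A x c (M v)))"
    if "linear M" for u and M :: "_ \<Rightarrow> 'e"
    by (rule linear_form_on_chart_vector[OF linear_form_on_sym[OF b chart_vector_in_tangent_space[OF c]] c that])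
  show ?thesis
    unfolding bilinear_def
  proof (intro conjI allI)
    show "linear (\<lambda>v. b (chart_vector A x c (L u)) (chart_vector A x c (K v)))" for u
      by (rule lin[OF K])
    show "linear (\<lambda>u. b (chart_vector A x c (L u)) (chart_vector A x c (K v)))" for v
      unfolding sym by (rule lin[OF L])
  qed
qed

text \<open>The factors 1 are kept so that the sum has literally the form produced by
  \<open>endomorphism_on_chart_vector_add\<close>.\<close>

lemma chart_vector_add:
  assumes "c \<in> A" "x \<in> fst c"
  shows "chart_vector A x c (u + v) = (\<lambda>d. 1 *\<^sub>R chart_vector A x c u d + 1 *\<^sub>R chart_vector A x c v d)"
  unfolding chart_vector_combination[OF assms] by simp

lemma symmetric_bilinear_form_on_add:
  assumes b: "symmetric_bilinear_form_on (tangent_space A x) b" and c: "c \<in> A" "x \<in> fst c"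
  shows "b (chart_vector A x c (u + u')) (chart_vector A x c (v + v')) =
    b (chart_vector A x c u) (chart_vector A x c v) + b (chart_vector A x c u) (chart_vector A x c v') +
    b (chart_vector A x c u') (chart_vector A x c v) + b (chart_vector A x c u') (chart_vector A x c v')"
  using bilinear_chart_vector[OF b c linear_ident linear_ident]
  by (simp add: bilinear_ladd[of "\<lambda>u v. b (chart_vector A x c u) (chart_vector A x c v)"]
      bilinear_radd[of "\<lambda>u v. b (chart_vector A x c u) (chart_vector A x c v)"])

lemma linear_endomorphism_chart_vector:
  assumes J: "endomorphism_on (tangent_space A x) J" and c: "c \<in> A" "x \<in> fst c" and L: "linear L"
  shows "linear (\<lambda>u. J (chart_vector A x c (L u)) d)"
proof -
  have comb: "J (chart_vector A x c (r *\<^sub>R u + s *\<^sub>R v)) d =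
      r *\<^sub>R J (chart_vector A x c u) d + s *\<^sub>R J (chart_vector A x c v) d" for r s u v
    unfolding chart_vector_combination[OF c, symmetric]
    using J chart_vector_in_tangent_space[OF c] unfolding endomorphism_on_def by metis
  show ?thesis
    using comb[of 1 _ 1] comb[of _ _ 0 0]
    by (intro linearI) (simp_all add: linear_add[OF L] linear_cmul[OF L])
qed

lemma endomorphism_on_chart_vector_add:
  assumes J: "endomorphism_on (tangent_space A x) J" and c: "c \<in> A" "x \<in> fst c"
  shows "J (chart_vector A x c (u + v)) =
    (\<lambda>d. 1 *\<^sub>R J (chart_vector A x c u) d + 1 *\<^sub>R J (chart_vector A x c v) d)"
  using linear_add[OF linear_endomorphism_chart_vector[OF J c linear_ident], of u v]
  by (intro ext) simp

end

section \<open>The metric and the frame in a chart\<close>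

locale riemannian = smooth_manifold A
  for A :: "('m::{t2_space,second_countable_topology}, real^'n) chart set" +
  fixes g :: "('m, real^'n) covariant2"
  assumes riemannian_metric: "riemannian_metric A g"
begin

lemma open_chart_image: "c \<in> A \<Longrightarrow> open (snd c ` fst c)"
  using open_overlap[of c c] by simp

lemma local_form_metric:
  assumes c: "c \<in> A" and y: "y \<in> snd c ` fst c"
  shows "local_form A g c y u v = u \<bullet> (metric_coeff A g c y *v v)"
proof (rule bilinear_eq_axis[of "local_form A g c y" "\<lambda>u v. u \<bullet> (metric_coeff A g c y *v v)"])
  have x: "chart_inv c y \<in> fst c"
    using y c by (auto simp: chart_inv_chart)
  have "symmetric_bilinear_form_on (tangent_space A (chart_inv c y)) (g (chart_inv c y))"
    using riemannian_metric unfolding riemannian_metric_def by blast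
  from bilinear_chart_vector[OF this c x linear_ident linear_ident]
  show "bilinear (local_form A g c y)"
    unfolding local_form_def[abs_def] .
  show "bilinear (\<lambda>u v. u \<bullet> (metric_coeff A g c y *v v))"
    using bilinear_matrix_form[of 1 _ 0] by simp
qed (simp add: axis_inner_matrix_axis metric_coeff_def)

lemma metric_coeff_smooth:
  "c \<in> A \<Longrightarrow> smooth_on (snd c ` fst c) (\<lambda>y. metric_coeff A g c y $ i $ j)"
  using riemannian_metric unfolding riemannian_metric_def by blast

lemma metric_coeff_differentiable:
  assumes c: "c \<in> A" and y: "y \<in> snd c ` fst c"
  shows "metric_coeff A g c differentiable (at y)"
  unfolding differentiable_vec_nth_iff
  using smooth_on_differentiable[OF metric_coeff_smooth[OF c] open_chart_image[OF c] y] by blast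

lemma metric_coeff_deriv_eq:
  assumes c: "c \<in> A" and y: "y \<in> snd c ` fst c"
  shows "frechet_derivative (\<lambda>z. metric_coeff A g c z $ i $ j) (at y) u =
    frechet_derivative (metric_coeff A g c) (at y) u $ i $ j"
proof -
  note D = metric_coeff_differentiable[OF c y]
  then have "(\<lambda>z. metric_coeff A g c z $ i) differentiable (at y)"
    unfolding differentiable_vec_nth_iff[of "metric_coeff A g c"] by blast
  from frechet_derivative_vec_nth[OF this, of j u] frechet_derivative_vec_nth[OF D, of i u]
  show ?thesis by simp
qed

lemma metric_coeff_derivative_differentiable:
  assumes c: "c \<in> A" and y: "y \<in> snd c ` fst c"
  shows "(\<lambda>z. frechet_derivative (metric_coeff A g c) (at z) u) differentiable (at y)"
  unfolding differentiable_vec_nth_iff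
proof (intro allI)
  fix i j
  obtain F where
    "((\<lambda>z. frechet_derivative (\<lambda>z. metric_coeff A g c z $ i $ j) (at z) u) has_derivative F) (at y)"
    using smooth_on_derivative_differentiable[OF metric_coeff_smooth[OF c] open_chart_image[OF c] y]
    unfolding differentiable_def by blast
  then have "((\<lambda>z. frechet_derivative (metric_coeff A g c) (at z) u $ i $ j) has_derivative F) (at y)"
    by (rule has_derivative_transform_within_open[OF _ open_chart_image[OF c] y])
      (simp add: metric_coeff_deriv_eq[OF c])
  then show "(\<lambda>z. frechet_derivative (metric_coeff A g c) (at z) u $ i $ j) differentiable (at y)"
    by (rule differentiableI)
qed

lemma metric_on_chart:
  assumes c: "c \<in> A"
  shows "metric_on (snd c ` fst c) (metric_coeff A g c)"
proof
  fix y assume y: "y \<in> snd c ` fst c"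
  let ?x = "chart_inv c y"
  have x: "?x \<in> fst c" using y c by (auto simp: chart_inv_chart)
  note in_T = chart_vector_in_tangent_space[OF c x]
  have "local_form A g c y u v = local_form A g c y v u" for u v
    using riemannian_metric in_T
    by (simp add: riemannian_metric_def symmetric_bilinear_form_on_def local_form_def)
  then show "transpose (metric_coeff A g c y) = metric_coeff A g c y"
    by (simp add: transpose_def metric_coeff_def)
  show "v \<bullet> (metric_coeff A g c y *v v) > 0" if "v \<noteq> 0" for v
  proof -
    \<comment> \<open>The component of this vector in the chart \<open>c\<close> itself is
      \<open>v\<close>.\<close>
    have "chart_vector A ?x c v \<noteq> (\<lambda>_. 0)"
      using that chart_vector_self[OF c x, of v] by metis
    then show ?thesis
      using riemannian_metric in_T
      unfolding riemannian_metric_def local_form_metric[OF c y, symmetric] local_form_def by blast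
  qed
qed (use open_chart_image[OF c] metric_coeff_differentiable[OF c] metric_coeff_derivative_differentiable[OF c]
    in blast)+

context
  fixes c :: "('m, real^'n) chart" and x :: 'm and p :: "real^'n"
  assumes c: "c \<in> A" and x: "x \<in> fst c"
begin

interpretation M: metric_on "snd c ` fst c" "metric_coeff A g c"
  by (rule metric_on_chart[OF c])

lemma chart_point_in_domain: "fst (snd c x, p) \<in> snd c ` fst c" using x by simp

lemma covector_coeff_eq: "covector_coeff A c (x, covector_of A c x p) = p"
  by (rule covector_coeff_covector_of_self[OF c x])

lemma energy_density_eq: "energy_density A g c (x, covector_of A c x p) = M.energy (snd c x, p)"
proof -
  have "(\<Sum>i\<in>UNIV. \<Sum>k\<in>UNIV. M.gu (snd c x) $ i $ k * p $ i * p $ k) = p \<bullet> (M.gu (snd c x) *v p)"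
    by (simp add: inner_vec_def matrix_vector_mult_def sum_distrib_left mult_ac)
  then show ?thesis
    unfolding energy_density_def covector_coeff_eq metric_inv_coeff_def M.energy_def M.raised_def fst_conv snd_conv
    by simp
qed

lemma raised_coeff_eq: "raised_coeff A g c (x, covector_of A c x p) i = M.raised (snd c x, p) $ i"
  unfolding M.raised_component[OF chart_point_in_domain]
  unfolding raised_coeff_def covector_coeff_eq metric_inv_coeff_def fst_conv snd_conv ..

lemma christoffel0_eq: "christoffel0 A g c (x, covector_of A c x p) i h = M.Gamma0 (snd c x, p) i h"
  unfolding christoffel0_def M.Gamma0_def christoffel_def M.Gamma_def covector_coeff_eq
    metric_coeff_deriv_def metric_coeff_deriv_eq[OF c imageI[OF x]] metric_inv_coeff_def fst_conv snd_conv ..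

lemma horizontal_frame_eq: "horizontal_frame A g c (x, covector_of A c x p) i =
    chart_vector (cotangent_atlas A) (x, covector_of A c x p) (cotangent_chart A c)
      (basis_vec i, M.lift (snd c x, p) (basis_vec i))"
  unfolding horizontal_frame_def christoffel0_eq M.lift_axis ..

end

end

section \<open>The fundamental form\<close>

text \<open>The common shape of \<open>J\<close> on horizontal and on vertical vectors.\<close>

lemma linear_inner_combination:
  fixes M :: "real^'n^'n"
  shows "linear (\<lambda>u. c *\<^sub>R (M *v u) + (d * (p \<bullet> u)) *\<^sub>R q)"
  by (rule linearI)
    (simp_all add: matrix_vector_right_distrib matrix_vector_mult_scaleR inner_add_right algebra_simps)

locale natural_diagonal = riemannian A g
  for A :: "('m::{t2_space,second_countable_topology}, real^'n) chart set"
    and g :: "('m, real^'n) covariant2" +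
  fixes a1 b1 lam mu :: "real \<Rightarrow> real"
    and G :: "('m \<times> ('m, 'n) covector, (real^'n) \<times> (real^'n)) covariant2"
    and J :: "('m \<times> ('m, 'n) covector, (real^'n) \<times> (real^'n)) endomorphism_field"
  assumes a1_pos: "\<And>t. t \<ge> 0 \<Longrightarrow> a1 t > 0"
    and ab_pos: "\<And>t. t \<ge> 0 \<Longrightarrow> a1 t + 2 * t * b1 t > 0"
    and diagonal_structure: "natural_diagonal_structure A g a1 b1 lam mu G J"

text \<open>Every point of the cotangent bundle over the domain of \<open>c\<close> arises from some
  \<open>x\<close> and \<open>p\<close>, so the algebra of \<open>G\<close> and \<open>J\<close> can
  be done with the point fixed.\<close>

locale natural_diagonal_at = natural_diagonal A g a1 b1 lam mu G J
  for A :: "('m::{t2_space,second_countable_topology}, real^'n) chart set"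
    and g :: "('m, real^'n) covariant2"
    and a1 b1 lam mu :: "real \<Rightarrow> real"
    and G :: "('m \<times> ('m, 'n) covector, (real^'n) \<times> (real^'n)) covariant2"
    and J :: "('m \<times> ('m, 'n) covector, (real^'n) \<times> (real^'n)) endomorphism_field" +
  fixes c :: "('m, real^'n) chart" and x :: 'm and p :: "real^'n"
  assumes c: "c \<in> A" and x: "x \<in> fst c"
begin

sublocale M: metric_on "snd c ` fst c" "metric_coeff A g c"
  by (rule metric_on_chart[OF c])

sublocale cot: C1_atlas "cotangent_atlas A" by (rule cotangent_atlas_C1_atlas)

definition covec :: "'m \<times> ('m, 'n) covector" where "covec = (x, covector_of A c x p)"

abbreviation "coords \<equiv> (snd c x, p)"
abbreviation "gl \<equiv> metric_coeff A g c (snd c x)"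
abbreviation "r \<equiv> M.raised coords"
abbreviation "cv \<equiv> chart_vector (cotangent_atlas A) covec (cotangent_chart A c)"
abbreviation "H u \<equiv> cv (u, M.lift coords u)"
abbreviation "V w \<equiv> cv (0, w)"
abbreviation "t \<equiv> M.energy coords"
definition "a2 = 1 / a1 t"
definition "b2 = - b1 t / (a1 t * (a1 t + 2 * t * b1 t))"
definition "d1 = lam t * b1 t + mu t * (a1 t + 2 * t * b1 t)"
definition "d2 = lam t * b2 + mu t * (a2 + 2 * t * b2)"

lemma covec_in_chart: "covec \<in> fst (cotangent_chart A c)" and chart_in_atlas: "cotangent_chart A c \<in> cotangent_atlas A"
  and covec_in_bundle: "covec \<in> cotangent_bundle A"
  using cotangent_chart_point(1)[OF c x, of p] c
  by (auto simp: covec_def cotangent_atlas_def cotangent_chart_def)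

lemma y_in: "fst coords \<in> snd c ` fst c" using x by simp

lemma
  shows J_H: "J covec (H (basis_vec i)) C = (\<Sum>j\<in>UNIV. (a1 t * gl $ i $ j + b1 t * p $ i * p $ j) *\<^sub>R V (basis_vec j) C)"
    and J_V: "J covec (V (basis_vec i)) C =
      (\<Sum>j\<in>UNIV. (- a2 * M.gu (snd c x) $ i $ j - b2 * r $ i * r $ j) *\<^sub>R H (basis_vec j) C)"
    and G_HH: "G covec (H (basis_vec i)) (H (basis_vec j)) = lam t * a1 t * gl $ i $ j + d1 * p $ i * p $ j"
    and G_VV: "G covec (V (basis_vec i)) (V (basis_vec j)) =
      lam t * a2 * M.gu (snd c x) $ i $ j + d2 * r $ i * r $ j"
    and G_VH: "G covec (V (basis_vec i)) (H (basis_vec j)) = 0"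
  using bspec[OF bspec[OF conjunct2[OF diagonal_structure[unfolded natural_diagonal_structure_def Let_def]] c] covec_in_chart]
  unfolding covec_def horizontal_frame_eq[OF c x] vertical_frame_def energy_density_eq[OF c x]
    raised_coeff_eq[OF c x] covector_coeff_eq[OF c x] metric_inv_coeff_def fst_conv
    a2_def b2_def d1_def d2_def
  by presburger+

lemma G_bilinear: "symmetric_bilinear_form_on (tangent_space (cotangent_atlas A) covec) (G covec)"
  and J_endomorphism: "endomorphism_on (tangent_space (cotangent_atlas A) covec) (J covec)"
  using diagonal_structure covec_in_bundle unfolding natural_diagonal_structure_def by blast+

lemma linear_H: "linear (\<lambda>u. (u, M.lift coords u))"
  using M.linear_lift[of coords] by (intro linearI) (auto simp: linear_add linear_cmul)

lemma linear_V: "linear (\<lambda>w. (0 :: real^'n, w :: real^'n))"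
  by (intro linearI) auto

lemmas cot_linear = cot.linear_chart_vector[OF chart_in_atlas covec_in_chart]

lemma linear_cv_comp: "linear L \<Longrightarrow> linear (\<lambda>u. cv (L u) C)"
  using linear_compose[OF _ cot_linear, of L C] by (simp add: o_def)

lemma gl_entry: "gl $ i $ j = gl $ j $ i"
  using M.symmetric[OF y_in] by (simp add: transpose_def vec_eq_iff)

lemma gu_entry: "M.gu (snd c x) $ i $ j = M.gu (snd c x) $ j $ i"
  using M.gu_self_adjoint[OF y_in, of "basis_vec i" "basis_vec j"]
  by (simp add: axis_inner_matrix_axis inner_commute[of _ "basis_vec j"])

text \<open>Both sides are linear in \<open>u\<close>, so the frame equations decide. These read row
  \<open>i\<close> of the metric, whereas the matrix product gives column \<open>i\<close>; symmetry
  of the metric reconciles the two.\<close>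

lemma J_horizontal: "J covec (H u) = V (a1 t *\<^sub>R (gl *v u) + (b1 t * (p \<bullet> u)) *\<^sub>R p)"
proof
  fix C
  let ?L = "\<lambda>u. a1 t *\<^sub>R (gl *v u) + (b1 t * (p \<bullet> u)) *\<^sub>R p"
  note V = linear_cv_comp[OF linear_V, of C]
  show "J covec (H u) C = V (?L u) C"
  proof (rule linear_eq_axis[of "\<lambda>u. J covec (H u) C" "\<lambda>u. V (?L u) C"])
    show "linear (\<lambda>u. J covec (H u) C)"
      by (rule cot.linear_endomorphism_chart_vector[OF J_endomorphism chart_in_atlas covec_in_chart linear_H])
    show "linear (\<lambda>u. V (?L u) C)"
      using linear_compose[OF linear_inner_combination V] unfolding o_def .
    show "J covec (H (basis_vec i)) C = V (?L (basis_vec i)) C" for i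
      unfolding J_H linear_axis_expansion[OF V, of "?L (basis_vec i)"]
      by (intro sum.cong arg_cong2[of _ _ _ _ scaleR] refl)
        (simp add: matrix_vector_mult_basis column_def inner_axis gl_entry[of i])
  qed
qed

lemma J_vertical: "J covec (V w) = H ((- a2) *\<^sub>R (M.gu (snd c x) *v w) + ((- b2) * (r \<bullet> w)) *\<^sub>R r)"
proof
  fix C
  let ?L = "\<lambda>w. (- a2) *\<^sub>R (M.gu (snd c x) *v w) + ((- b2) * (r \<bullet> w)) *\<^sub>R r"
  note H = linear_cv_comp[OF linear_H, of C]
  show "J covec (V w) C = H (?L w) C"
  proof (rule linear_eq_axis[of "\<lambda>w. J covec (V w) C" "\<lambda>w. H (?L w) C"])
    show "linear (\<lambda>w. J covec (V w) C)"
      by (rule cot.linear_endomorphism_chart_vector[OF J_endomorphism chart_in_atlas covec_in_chart linear_V])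
    show "linear (\<lambda>w. H (?L w) C)"
      using linear_compose[OF linear_inner_combination H] unfolding o_def .
    show "J covec (V (basis_vec i)) C = H (?L (basis_vec i)) C" for i
      unfolding J_V linear_axis_expansion[OF H, of "?L (basis_vec i)"]
      by (intro sum.cong arg_cong2[of _ _ _ _ scaleR] refl)
        (simp add: matrix_vector_mult_basis column_def inner_axis gu_entry[of i])
  qed
qed

lemmas G_bilinear_chart_vector = cot.bilinear_chart_vector[OF G_bilinear chart_in_atlas covec_in_chart]

lemma G_horizontal: "G covec (H u) (H v) = lam t * a1 t * (u \<bullet> (gl *v v)) + d1 * (p \<bullet> u) * (p \<bullet> v)"
  by (rule bilinear_eq_axis[OF G_bilinear_chart_vector[OF linear_H linear_H] bilinear_matrix_form])
    (simp only: G_HH axis_inner_matrix_axis inner_axis inner_real_def mult_1_right)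

lemma G_vertical: "G covec (V u) (V v) = lam t * a2 * (u \<bullet> (M.gu (snd c x) *v v)) + d2 * (r \<bullet> u) * (r \<bullet> v)"
  by (rule bilinear_eq_axis[OF G_bilinear_chart_vector[OF linear_V linear_V] bilinear_matrix_form])
    (simp only: G_VV axis_inner_matrix_axis inner_axis inner_real_def mult_1_right)

lemma G_mixed: "G covec (V u) (H v) = 0" "G covec (H v) (V u) = 0"
proof -
  have "bilinear (\<lambda>u v :: real^'n. 0 :: real)" by (simp add: bilinear_def linear_zero)
  from bilinear_eq_axis[OF G_bilinear_chart_vector[OF linear_V linear_H] this G_VH]
  show "G covec (V u) (H v) = 0" .
  moreover have "G covec (H v) (V u) = G covec (V u) (H v)"
    using G_bilinear cot.chart_vector_in_tangent_space[OF chart_in_atlas covec_in_chart]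
    by (simp add: symmetric_bilinear_form_on_def)
  ultimately show "G covec (H v) (V u) = 0" by simp
qed

text \<open>The coefficients that survive in the fundamental form. All rest on
  \<open>a2 + 2 * t * b2\<close> being the inverse of \<open>a1 t + 2 * t * b1 t\<close>: the terms
  with \<open>lam\<close> and \<open>b1\<close> then cancel in the last two identities.\<close>

lemma scalars:
  "lam t * a1 t * a2 = lam t"
  "lam t * a2 * b1 t + d2 * (a1 t + 2 * t * b1 t) = mu t"
  "lam t * a1 t * b2 + d1 * (a2 + 2 * t * b2) = mu t"
proof -
  have t0: "t \<ge> 0" by (rule M.energy_nonneg[OF y_in])
  define e where "e = a1 t + 2 * t * b1 t"
  have nz: "a1 t \<noteq> 0" "e \<noteq> 0"
    using a1_pos[OF t0] ab_pos[OF t0] by (auto simp: e_def)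
  have b2: "b2 = - b1 t / (a1 t * e)" by (simp add: b2_def e_def)
  have ab2: "a2 + 2 * t * b2 = 1 / e"
  proof -
    have "a2 + 2 * t * b2 = (e - 2 * t * b1 t) / (a1 t * e)"
      using nz by (simp add: a2_def b2 diff_divide_distrib)
    also have "e - 2 * t * b1 t = a1 t" by (simp add: e_def)
    finally show ?thesis using nz by simp
  qed
  show "lam t * a1 t * a2 = lam t" using nz by (simp add: a2_def)
  show "lam t * a2 * b1 t + d2 * (a1 t + 2 * t * b1 t) = mu t"
    unfolding d2_def ab2 e_def[symmetric] using nz by (simp add: b2 a2_def field_simps)
  show "lam t * a1 t * b2 + d1 * (a2 + 2 * t * b2) = mu t"
    unfolding d1_def ab2 e_def[symmetric] using nz by (simp add: b2 add_divide_distrib)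
qed

text \<open>\<open>J\<close> exchanges horizontal and vertical vectors and \<open>G\<close> makes
  them orthogonal, so after splitting both arguments only two of the four products remain.\<close>

lemma fundamental_form_chart:
  "fundamental_form G J covec (cv X) (cv Y) = M.Phi lam mu coords X Y"
proof -
  have split: "X = (fst X, M.lift coords (fst X)) + (0, M.vertical_part coords X)" for X
    by (simp add: M.vertical_part_def prod_eq_iff)
  define W W' u u' where defs: "W = M.vertical_part coords X" "W' = M.vertical_part coords Y" "u = fst X" "u' = fst Y"
  let ?A = "a1 t *\<^sub>R (gl *v u') + (b1 t * (p \<bullet> u')) *\<^sub>R p"
  let ?v = "(- a2) *\<^sub>R (M.gu (snd c x) *v W') + ((- b2) * (r \<bullet> W')) *\<^sub>R r"
  \<comment> \<open>This pairing is the source of every factor \<open>2 * t\<close> in the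
    coefficients.\<close>
  have rp: "r \<bullet> p = 2 * t" "p \<bullet> r = 2 * t"
    by (simp_all add: M.energy_def inner_commute)
  have r_gl: "r \<bullet> (gl *v v) = p \<bullet> v" for v
    using M.gl_self_adjoint[OF y_in, of r v] M.gl_raised[OF y_in] by simp
  have p_gu: "p \<bullet> (M.gu (snd c x) *v v) = r \<bullet> v" for v
    using M.gu_self_adjoint[OF y_in, of p v] by (simp add: M.raised_def)
  have gu_p: "M.gu (snd c x) *v p = r" by (simp add: M.raised_def)
  have gl_r: "gl *v r = p" using M.gl_raised[OF y_in] by simp
  have gu_A: "M.gu (snd c x) *v ?A = a1 t *\<^sub>R u' + (b1 t * (p \<bullet> u')) *\<^sub>R r"
    using M.gu_gl[OF y_in, of u']
    by (simp add: matrix_vector_right_distrib matrix_vector_mult_scaleR gu_p)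
  have gl_v: "gl *v ?v = (- a2) *\<^sub>R W' + ((- b2) * (r \<bullet> W')) *\<^sub>R p"
    using M.gl_gu[OF y_in, of W']
    by (simp only: matrix_vector_right_distrib matrix_vector_mult_scaleR gl_r fst_conv)
  have r_A: "r \<bullet> ?A = (a1 t + 2 * t * b1 t) * (p \<bullet> u')"
    by (simp add: inner_add_right r_gl rp algebra_simps)
  have p_v: "p \<bullet> ?v = - (a2 + 2 * t * b2) * (r \<bullet> W')"
    by (simp only: inner_add_right inner_scaleR_right p_gu rp) algebra
  have "J covec (cv Y) = J covec (cv ((u', M.lift coords u') + (0, W')))"
    unfolding defs by (subst split[of Y]) simp
  also have "\<dots> = (\<lambda>d. 1 *\<^sub>R V ?A d + 1 *\<^sub>R H ?v d)"
    unfolding cot.endomorphism_on_chart_vector_add[OF J_endomorphism chart_in_atlas covec_in_chart]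
      J_horizontal J_vertical ..
  also have "\<dots> = cv ((?v, M.lift coords ?v) + (0, ?A))"
    unfolding cot.chart_vector_add[OF chart_in_atlas covec_in_chart]
    by (simp only: add.commute)
  finally have JY: "J covec (cv Y) = cv ((?v, M.lift coords ?v) + (0, ?A))" .
  have X: "cv X = cv ((u, M.lift coords u) + (0, W))"
    unfolding defs by (subst split[of X]) simp
  have "fundamental_form G J covec (cv X) (cv Y) = G covec (H u) (H ?v) + G covec (V W) (V ?A)"
    unfolding fundamental_form_def JY X
      cot.symmetric_bilinear_form_on_add[OF G_bilinear chart_in_atlas covec_in_chart] G_mixed
    by simp
  also have "\<dots> = lam t * a1 t * (- a2 * (u \<bullet> W') - b2 * (r \<bullet> W') * (u \<bullet> p))
      + d1 * (p \<bullet> u) * (- (a2 + 2 * t * b2) * (r \<bullet> W'))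
      + (lam t * a2 * (a1 t * (W \<bullet> u') + b1 t * (p \<bullet> u') * (W \<bullet> r))
      + d2 * (r \<bullet> W) * ((a1 t + 2 * t * b1 t) * (p \<bullet> u')))"
    unfolding G_horizontal G_vertical gu_A gl_v r_A p_v
    by (simp only: inner_add_right inner_scaleR_right) simp
  \<comment> \<open>Regrouped so that exactly the three combinations of \<open>scalars\<close>
    appear as coefficients.\<close>
  also have "\<dots> = (lam t * a1 t * a2) * (W \<bullet> u' - W' \<bullet> u)
     + (lam t * a2 * b1 t + d2 * (a1 t + 2 * t * b1 t)) * ((r \<bullet> W) * (p \<bullet> u'))
     - (lam t * a1 t * b2 + d1 * (a2 + 2 * t * b2)) * ((r \<bullet> W') * (p \<bullet> u))"
    by (simp only: inner_commute[of u] inner_commute[of W r]) algebra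
  also have "\<dots> = lam t * (W \<bullet> u' - W' \<bullet> u) + mu t * (r \<bullet> W * (p \<bullet> u')) - mu t * (r \<bullet> W' * (p \<bullet> u))"
    unfolding scalars ..
  also have "\<dots> = M.Phi lam mu coords X Y"
    unfolding M.Phi_def M.canonical_form_eq_vertical_part[OF y_in] M.denergy_eq_vertical_part[OF y_in] defs
    by (simp add: algebra_simps)
  finally show ?thesis .
qed

end

section \<open>Closedness of the fundamental form\<close>

context natural_diagonal
begin

context
  fixes c :: "('m, real^'n) chart"
  assumes c: "c \<in> A"
begin

interpretation M: metric_on "snd c ` fst c" "metric_coeff A g c"
  by (rule metric_on_chart[OF c])

abbreviation (input) local_phi ::
  "(real^'n) \<times> (real^'n) \<Rightarrow> (real^'n) \<times> (real^'n) \<Rightarrow> (real^'n) \<times> (real^'n) \<Rightarrow> real" where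
  "local_phi z X Y \<equiv> local_form (cotangent_atlas A) (fundamental_form G J) (cotangent_chart A c) z X Y"

lemma local_form_fundamental_form:
  assumes z: "z \<in> snd c ` fst c \<times> UNIV"
  shows "local_phi z X Y = M.Phi lam mu z X Y"
proof -
  obtain x p where x: "x \<in> fst c" and z_eq: "z = (snd c x, p)" using z by auto
  interpret N: natural_diagonal_at A g a1 b1 lam mu G J c x p
    by unfold_locales (use c x in auto)
  show ?thesis
    using N.fundamental_form_chart[of X Y]
    by (simp add: local_form_def z_eq chart_inv_cotangent_chart[OF c x] N.covec_def)
qed

context
  fixes z :: "(real^'n) \<times> (real^'n)" and lam' mu' :: real
  assumes z: "z \<in> snd c ` fst c \<times> UNIV"
    and lam': "(lam has_real_derivative lam') (at (M.energy z) within {0..})"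
    and mu': "(mu has_real_derivative mu') (at (M.energy z) within {0..})"
begin

lemma Phi_differentiable: "(\<lambda>z. M.Phi lam mu z X Y) differentiable (at z)"
proof -
  have "fst z \<in> snd c ` fst c" using z by auto
  from M.Phi_has_derivative[OF this lam' mu'] show ?thesis by (rule differentiableI)
qed

lemma local_form_fundamental_form_differentiable: "(\<lambda>z. local_phi z X Y) differentiable (at z)"
  and frechet_derivative_local_form_fundamental_form:
    "frechet_derivative (\<lambda>z. local_phi z X Y) (at z) = frechet_derivative (\<lambda>z. M.Phi lam mu z X Y) (at z)"
proof -
  have "((\<lambda>z. M.Phi lam mu z X Y) has_derivative frechet_derivative (\<lambda>z. M.Phi lam mu z X Y) (at z)) (at z)"
    using Phi_differentiable by (simp add: frechet_derivative_works)
  then have D: "((\<lambda>z. local_phi z X Y) has_derivative frechet_derivative (\<lambda>z. M.Phi lam mu z X Y) (at z)) (at z)"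
    by (rule has_derivative_transform_within_open[OF _ M.open_domain z])
      (simp add: local_form_fundamental_form)
  then show "(\<lambda>z. local_phi z X Y) differentiable (at z)" by (rule differentiableI)
  show "frechet_derivative (\<lambda>z. local_phi z X Y) (at z) = frechet_derivative (\<lambda>z. M.Phi lam mu z X Y) (at z)"
    using frechet_derivative_at[OF D] by simp
qed

lemma exterior_derivative_fundamental_form:
  "exterior_derivative (cotangent_atlas A) (fundamental_form G J) (cotangent_chart A c) z X Y Z =
    (lam' - mu (M.energy z)) * M.denergy_wedge_canonical z X Y Z"
proof -
  have "fst z \<in> snd c ` fst c" using z by auto
  from M.Phi_exterior_derivative[OF this lam' mu'] show ?thesis
    unfolding exterior_derivative_def frechet_derivative_local_form_fundamental_form .
qed

end

text \<open>Over a fixed point the energy is homogeneous of degree 2 in p, so scaling one nonzero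
  covector reaches every value.\<close>

lemma exists_point_of_energy:
  assumes "fst c \<noteq> {}" and "s \<ge> 0"
  obtains z where "z \<in> snd c ` fst c \<times> UNIV" "M.energy z = s"
proof -
  obtain x where x: "x \<in> fst c" using assms by auto
  \<comment> \<open>Any nonzero covector would do; \<open>undefined\<close> is an arbitrary
    index.\<close>
  define q :: "real^'n" where "q = axis undefined 1"
  define e where "e = M.energy (snd c x, q)"
  have "q \<noteq> 0" by (simp add: q_def axis_eq_0_iff)
  then have e: "e > 0"
    using M.energy_nonneg[of "(snd c x, q)"] M.energy_eq_0_iff[of "(snd c x, q)"] x
    by (simp add: e_def less_le)
  have "M.energy (snd c x, k *\<^sub>R q) = k\<^sup>2 * e" for k
    by (simp add: M.energy_def M.raised_def e_def matrix_vector_mult_scaleR power2_eq_square)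
  then have "M.energy (snd c x, sqrt (s / e) *\<^sub>R q) = s"
    using e assms(2) by simp
  then show ?thesis using that x by blast
qed

end

theorem almost_kaehlerian_iff:
  assumes n: "CARD('n) > 1"
    and lam: "smooth_on_half_line lam" and mu: "smooth_on_half_line mu"
  shows "almost_kaehlerian (cotangent_atlas A) G J \<longleftrightarrow>
    (\<forall>t\<ge>0. (lam has_real_derivative mu t) (at t within {0..}))"
proof -
  obtain D where D: "D 0 = mu" "\<And>k t. t \<ge> 0 \<Longrightarrow> (D k has_real_derivative D (Suc k) t) (at t within {0..})"
    using mu unfolding smooth_on_half_line_def by blast
  then have mu': "(mu has_real_derivative D 1 t) (at t within {0..})" if "t \<ge> 0" for t
    using D(2)[OF that, of 0] by simp
  \<comment> \<open>\<open>L 1\<close> is the derivative of \<open>lam\<close>; \<open>L 2\<close>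
    supplies the continuity of \<open>L 1\<close> at 0.\<close>
  obtain L where L: "L 0 = lam" "\<And>k t. t \<ge> 0 \<Longrightarrow> (L k has_real_derivative L (Suc k) t) (at t within {0..})"
    using lam unfolding smooth_on_half_line_def by blast
  have lam': "(lam has_real_derivative L 1 t) (at t within {0..})"
    and lam'': "(L 1 has_real_derivative L 2 t) (at t within {0..})" if "t \<ge> 0" for t
    using L(2)[OF that, of 0] L(2)[OF that, of 1] by (simp_all add: L(1) numeral_2_eq_2)
  show ?thesis
  proof
    assume K: "almost_kaehlerian (cotangent_atlas A) G J"
    have pos: "L 1 t = mu t" if t: "t > 0" for t
    proof -
      \<comment> \<open>One chart with nonempty domain suffices, since all energies occur over each
        of its points.\<close>
      obtain c where c: "c \<in> A" "fst c \<noteq> {}"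
        using smooth_atlas unfolding smooth_atlas_def by blast
      interpret M: metric_on "snd c ` fst c" "metric_coeff A g c"
        by (rule metric_on_chart[OF c(1)])
      obtain z where z: "z \<in> snd c ` fst c \<times> UNIV" "M.energy z = t"
        using exists_point_of_energy[OF c, of t] t by auto
      have "fst z \<in> snd c ` fst c" "M.energy z \<noteq> 0" using z t by auto
      then obtain X Y Z where nz: "M.denergy_wedge_canonical z X Y Z \<noteq> 0"
        by (rule M.denergy_wedge_canonical_nonzero[OF _ _ n])
      have "exterior_derivative (cotangent_atlas A) (fundamental_form G J) (cotangent_chart A c) z X Y Z = 0"
        using K c(1) z(1) cotangent_chart_image[OF c(1)]
        unfolding almost_kaehlerian_def closed_2form_def cotangent_atlas_def by blast
      moreover have "exterior_derivative (cotangent_atlas A) (fundamental_form G J) (cotangent_chart A c) z X Y Z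
          = (L 1 t - mu t) * M.denergy_wedge_canonical z X Y Z"
        using exterior_derivative_fundamental_form[OF c(1) z(1)] lam'[of t] mu'[of t] t unfolding z(2) by simp
      ultimately show ?thesis using nz by simp
    qed
    \<comment> \<open>Energy 0 occurs only on the zero section, where dt \<and> \<omega> vanishes
      and closedness gives no information; the value at 0 is obtained as a limit from the
      right.\<close>
    have "L 1 0 = mu 0"
    proof (rule tendsto_unique[OF trivial_limit_at_right_real])
      have "(L 1 \<longlongrightarrow> L 1 0) (at 0 within {0..})" "(mu \<longlongrightarrow> mu 0) (at 0 within {0..})"
        using DERIV_continuous[OF lam''[of 0]] DERIV_continuous[OF mu'[of 0]] by (simp_all add: continuous_within)
      then have l: "(L 1 \<longlongrightarrow> L 1 0) (at_right 0)" and m: "(mu \<longlongrightarrow> mu 0) (at_right 0)"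
        by (auto intro: tendsto_within_subset)
      show "(L 1 \<longlongrightarrow> L 1 0) (at_right 0)" by (rule l)
      have "\<forall>\<^sub>F t in at_right 0. mu t = L 1 t"
        using eventually_at_right_less[of 0] by (rule eventually_mono) (rule pos[symmetric])
      with m show "(L 1 \<longlongrightarrow> mu 0) (at_right 0)" by (rule Lim_transform_eventually)
    qed
    then have "L 1 t = mu t" if "t \<ge> 0" for t
      using that pos[of t] by (cases "t = 0") auto
    then show "\<forall>t\<ge>0. (lam has_real_derivative mu t) (at t within {0..})"
      using lam' by metis
  next
    assume eq: "\<forall>t\<ge>0. (lam has_real_derivative mu t) (at t within {0..})"
    show "almost_kaehlerian (cotangent_atlas A) G J"
      unfolding almost_kaehlerian_def closed_2form_def
    proof (intro ballI conjI allI)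
      fix C z X Y
      assume "C \<in> cotangent_atlas A" and z: "z \<in> snd C ` fst C"
      then obtain c where c: "c \<in> A" and C: "C = cotangent_chart A c" by (auto simp: cotangent_atlas_def)
      interpret M: metric_on "snd c ` fst c" "metric_coeff A g c"
        by (rule metric_on_chart[OF c])
      have z: "z \<in> snd c ` fst c \<times> UNIV" using z cotangent_chart_image[OF c] by (simp add: C)
      then have t: "M.energy z \<ge> 0" by (intro M.energy_nonneg) auto
      show "(\<lambda>z. local_form (cotangent_atlas A) (fundamental_form G J) C z X Y) differentiable (at z)"
        unfolding C by (rule local_form_fundamental_form_differentiable[OF c z lam'[OF t] mu'[OF t]])
      fix Z
      show "exterior_derivative (cotangent_atlas A) (fundamental_form G J) C z X Y Z = 0"
        using exterior_derivative_fundamental_form[OF c z eq[rule_format, OF t] mu'[OF t]] by (simp add: C)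
    qed
  qed
qed

end

theorem theorem6:
  fixes A :: "('m::{t2_space,second_countable_topology}, real^'n) chart set"
    and g :: "('m, real^'n) covariant2"
    and a1 b1 lam mu :: "real \<Rightarrow> real"
    and G :: "('m \<times> ('m, 'n) covector, (real^'n) \<times> (real^'n)) covariant2"
    and J :: "('m \<times> ('m, 'n) covector, (real^'n) \<times> (real^'n)) endomorphism_field"
  assumes "riemannian_manifold A g"
    and "CARD('n) > 1"
    and "smooth_on_half_line a1" and "smooth_on_half_line b1"
    and "smooth_on_half_line lam" and "smooth_on_half_line mu"
    and "\<And>t. t \<ge> 0 \<Longrightarrow> a1 t > 0"
    and "\<And>t. t \<ge> 0 \<Longrightarrow> a1 t + 2 * t * b1 t > 0"
    and "\<And>t. t \<ge> 0 \<Longrightarrow> lam t > 0"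
    and "\<And>t. t \<ge> 0 \<Longrightarrow> lam t + 2 * t * mu t > 0"
    and "natural_diagonal_structure A g a1 b1 lam mu G J"
  shows "almost_kaehlerian (cotangent_atlas A) G J \<longleftrightarrow>
    (\<forall>t\<ge>0. (lam has_real_derivative mu t) (at t within {0..}))"
proof -
  interpret natural_diagonal A g a1 b1 lam mu G J
    by unfold_locales (use assms in \<open>auto simp: riemannian_manifold_def\<close>)
  show ?thesis by (rule almost_kaehlerian_iff[OF assms(2,5,6)])
qed

end
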